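(* For any convex body $K$ in $\mathbb{R}^n$ containing the origin in its interior, $$\mathrm{Vol}(K)\cdot \mathrm{Vol}(K^\circ) \;>\; \max\left\{ \mathrm{evr}(K)^n,\ \mathrm{evr}(K^\circ)^n \right\}\, \omega_n^2 .$$ In particular, if $K$ is symmetric about the origin, then $$\mathrm{Vol}(K)\cdot \mathrm{Vol}(K^\circ) \;>\; \left[ \frac{2^n\, \Gamma\!\left(\frac{n}{2}+1\right)}{n!\, \pi^{n/2}}\right]\, \omega_n^2,$$ while, for arbitrary convex bodies $K$ (containing the origin in their interior), $$\mathrm{Vol}(K)\cdot \mathrm{Vol}(K^\circ) \;>\; \left[\frac{(n+1)^{\frac{n+1}{2}}\, \Gamma\!\left(\frac{n}{2}+1\right)}{n!\, (n\pi)^{n/2}} \right]\, \omega_n^2 .$$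
   Context: A convex body in $\mathbb{R}^n$ is a compact convex set. $\mathrm{Vol}$ denotes $n$-dimensional Lebesgue measure, and $\omega_n$ is the volume of the Euclidean unit ball in $\mathbb{R}^n$. For a convex body $K$ containing the origin in its interior, $K^\circ=\{x\in\mathbb{R}^n : x\cdot y\le 1 \text{ for all } y\in K\}$ is its polar body with respect to the origin. The exterior volume ratio of a convex body $K$ is $$\mathrm{evr}(K)=\max_{K\subseteq\mathcal{E}}\left(\frac{\mathrm{Vol}(K)}{\mathrm{Vol}(\mathcal{E})}\right)^{1/n},$$ where the maximum is over all ellipsoids $\mathcal{E}$ containing $K$; the maximizing ellipsoid is called the Löwner ellipsoid of $K$. $\Gamma$ is the Gamma function.
   Formalization: Strictness fails for ellipsoids centred at 0 (first bound), for n = 1 (symmetric bound), and for K=[-a,a] with n = 1 (general bound), where equality holds; the formal theorem claims ≥ in all cases and > in all the others. *)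

theory Defs
  imports "HOL-Analysis.Analysis"
begin

abbreviation vol :: "(real^'n) set \<Rightarrow> real"
  where "vol \<equiv> measure lebesgue"

definition polar_body :: "(real^'n) set \<Rightarrow> (real^'n) set"
  where "polar_body K = {x. \<forall>y\<in>K. x \<bullet> y \<le> 1}"

text \<open>Ellipsoids are solid and nondegenerate.\<close>

definition ellipsoid_at :: "real^'n \<Rightarrow> (real^'n) set \<Rightarrow> bool"
  where "ellipsoid_at c E \<longleftrightarrow>
    (\<exists>A :: real^'n^'n. invertible A \<and> E = (\<lambda>x. c + A *v x) ` cball 0 1)"

definition ellipsoid :: "(real^'n) set \<Rightarrow> bool"
  where "ellipsoid E \<longleftrightarrow> (\<exists>c. ellipsoid_at c E)"

text \<open>The exterior volume ratio.  \<open>Greatest\<close> is the literal maximum: it is determined only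
  where the maximum over the containing ellipsoids is attained, as it is for every compact
  \<open>K\<close> with nonempty interior (the maximizer is the Loewner ellipsoid).\<close>

definition evr :: "(real^'n) set \<Rightarrow> real"
  where "evr K = (GREATEST r. \<exists>E. ellipsoid E \<and> K \<subseteq> E \<and> r = root CARD('n) (vol K / vol E))"

end

theory Submission
  imports Defs "HOL-Probability.Distributions"
begin

text \<open>
  Let \<open>E = {x. \<bar>M x - b\<bar> \<le> 1}\<close> be the Loewner ellipsoid of \<open>K\<close>. The polar body of \<open>K\<close> contains that
  of \<open>E\<close>, which is a linear image, with determinant \<open>\<plusminus>det M\<close>, of \<open>{z. \<bar>z\<bar> + z \<bullet> b \<le> 1}\<close>. The volume of
  the latter set is at least that of the unit ball, with equality only for \<open>b = 0\<close>, whence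
  \<open>Vol K * Vol K\<^sup>\<circ> \<ge> (Vol K / Vol E) * \<omega>\<^sub>n\<^sup>2\<close>.
  If \<open>E\<close> is the unit ball, John's theorem yields contact points \<open>u\<close> with
  \<open>\<Sum> c\<^sub>u u\<otimes>u = I\<close> and \<open>\<Sum> c\<^sub>u u = 0\<close>, and Barthe's reverse form of the Brascamp-Lieb inequality,
  proved by transporting a Gaussian measure, shows that \<open>K\<close> is at least as large as the inscribed
  regular simplex, or the inscribed cross-polytope when \<open>K\<close> is symmetric. For the simplex one applies
  it to lifted vectors in dimension \<open>n + 1\<close> and an exponential density, for the cross-polytope to the
  vectors \<open>u\<close> themselves and a Laplace density.
\<close>

text \<open>Strictness is the delicate point. A centred ellipsoid has \<open>evr\<close> 1 and
  volume product omega_n^2, and for n = 1 both explicit constants equal 1 while every body symmetric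
  about the origin is a centred interval. Hence each bound is proved twice: non-strictly, and
  strictly for \<open>K\<close> that is not an ellipsoid centred at the origin. Centred ellipsoids
  are then treated on their own for n >= 2, where both explicit constants are below 1. Volumes enter
  the functional inequality through exponential integrals over cones, such as the integral of exp of
  minus the gauge, which equals n! Vol K. This is the source of n! in the constants; the factor 2^n
  comes from the mass 2 of the Laplace density. The substitution in Barthe's inequality is shown to
  be injective but not onto, so the change of variables is used as an inequality. Its Jacobian
  matrix is a positive combination of rank-one matrices, which is why a lower bound for determinants
  of such sums is proved beforehand.\<close>

section \<open>Reindexing coordinates\<close>

text \<open>The change-of-variables theorems of the library are restricted to well-ordered finite index
  types. The following type is a well-ordered copy of an arbitrary finite type.\<close>

typedef ('a::finite) idx = "{..<CARD('a)}"
  by (rule exI[of _ 0]) (simp add: zero_less_card_finite)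


instance idx :: (finite) finite
proof
  show "finite (UNIV :: 'a idx set)"
    by (simp add: type_definition.univ[OF type_definition_idx])
qed

instantiation idx :: (finite) wellorder
begin

definition "less_eq_idx (a::'a idx) (b::'a idx) \<longleftrightarrow> Rep_idx a \<le> Rep_idx b"
definition "less_idx (a::'a idx) (b::'a idx) \<longleftrightarrow> Rep_idx a < Rep_idx b"

instance
proof
  fix P and a :: "'a idx"
  assume step: "\<And>x :: 'a idx. (\<And>y. y < x \<Longrightarrow> P y) \<Longrightarrow> P x"
  show "P a"
    by (induction a rule: measure_induct_rule[of Rep_idx]) (auto intro: step simp: less_idx_def)
qed (auto simp: less_eq_idx_def less_idx_def Rep_idx_inject)

end

lemma card_idx: "CARD('a::finite idx) = CARD('a)"
  by (simp add: type_definition.card[OF type_definition_idx])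

definition reindex :: "('b::finite \<Rightarrow> 'a) \<Rightarrow> real^'a \<Rightarrow> real^'b"
  where "reindex \<iota> x = (\<chi> k. x $ \<iota> k)"

lemma linear_reindex: "linear (reindex \<iota>)"
  by (rule linearI) (auto simp: reindex_def vec_eq_iff)

lemma reindex_inverse:
  assumes "bij \<iota>"
  shows "reindex \<iota> (reindex (inv \<iota>) x) = x" "reindex (inv \<iota>) (reindex \<iota> y) = y"
  using assms by (auto simp: reindex_def vec_eq_iff bij_is_inj bij_is_surj surj_f_inv_f)

lemma borel_measurable_reindex [measurable]: "reindex \<iota> \<in> borel_measurable borel"
  by (intro borel_measurable_continuous_onI linear_continuous_on)
     (simp add: linear_reindex linear_conv_bounded_linear[symmetric])

lemma prod_Basis_cart: "(\<Prod>b\<in>Basis. f b) = (\<Prod>i\<in>UNIV. f (axis i (1::real) :: real^'n))"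
proof -
  have "(\<Prod>b\<in>(\<lambda>i. axis i (1::real) :: real^'n) ` UNIV. f b) = (\<Prod>i\<in>UNIV. f (axis i (1::real) :: real^'n))"
    by (subst prod.reindex) (auto simp: inj_on_def axis_eq_axis)
  moreover have "(Basis :: (real^'n) set) = (\<lambda>i. axis i 1) ` UNIV"
    by (auto simp: Basis_vec_def)
  ultimately show ?thesis by simp
qed

lemma distr_reindex:
  fixes \<iota> :: "'b::finite \<Rightarrow> 'a::finite"
  assumes "bij \<iota>"
  shows "distr lborel borel (reindex \<iota>) = lborel"
proof (rule lborel_eqI[symmetric])
  fix l u :: "real^'b" assume lu: "\<And>b. b \<in> Basis \<Longrightarrow> l \<bullet> b \<le> u \<bullet> b"
  have lu': "l $ k \<le> u $ k" for k
    using lu[of "axis k 1"] by (simp add: axis_in_Basis_iff inner_axis)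
  have "reindex \<iota> -` box l u = box (reindex (inv \<iota>) l) (reindex (inv \<iota>) u)"
  proof (rule set_eqI)
    fix x
    have "x \<in> reindex \<iota> -` box l u \<longleftrightarrow> (\<forall>k. l $ k < x $ \<iota> k \<and> x $ \<iota> k < u $ k)"
      by (simp add: mem_box_cart reindex_def)
    also have "\<dots> \<longleftrightarrow> (\<forall>i. l $ inv \<iota> i < x $ i \<and> x $ i < u $ inv \<iota> i)"
      using assms by (metis bij_inv_eq_iff)
    finally show "x \<in> reindex \<iota> -` box l u \<longleftrightarrow> x \<in> box (reindex (inv \<iota>) l) (reindex (inv \<iota>) u)"
      by (simp add: mem_box_cart reindex_def)
  qed
  then have "emeasure (distr lborel borel (reindex \<iota>)) (box l u)
      = emeasure lborel (box (reindex (inv \<iota>) l) (reindex (inv \<iota>) u))"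
    by (subst emeasure_distr) auto
  also have "\<dots> = (\<Prod>i\<in>UNIV. ennreal (u $ inv \<iota> i - l $ inv \<iota> i))"
  proof (subst emeasure_lborel_box)
    show "reindex (inv \<iota>) l \<bullet> b \<le> reindex (inv \<iota>) u \<bullet> b" if "b \<in> Basis" for b
      using that lu' by (auto simp: Basis_vec_def inner_axis reindex_def)
  qed (use lu' in \<open>simp add: inner_axis reindex_def prod_Basis_cart prod_ennreal\<close>)
  also have "\<dots> = (\<Prod>k\<in>UNIV. ennreal (u $ k - l $ k))"
    by (rule prod.reindex_bij_betw[of "inv \<iota>"]) (simp add: assms bij_imp_bij_inv)
  finally show "emeasure (distr lborel borel (reindex \<iota>)) (box l u) = ennreal (prod ((\<bullet>) (u - l)) Basis)"
    using lu' by (simp add: prod_Basis_cart prod_ennreal inner_axis)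
qed simp

text \<open>Conjugation by \<open>\<iota>\<close> is a sign-preserving bijection between the
  permutations of the two index types, so the Leibniz expansions agree term by term.\<close>

lemma det_reindex:
  fixes A :: "'r::comm_ring_1^'a^'a" and \<iota> :: "'b::finite \<Rightarrow> 'a::finite"
  assumes "bij \<iota>"
  shows "det (\<chi> k l. A $ \<iota> k $ \<iota> l) = det A"
proof -
  let ?m = "map_permutation UNIV \<iota>"
  have inj: "inj \<iota>" and img: "bij_betw \<iota> UNIV UNIV" using assms by (auto simp: bij_is_inj)
  have m: "?m p permutes UNIV" if "p permutes UNIV" for p
    using map_permutation_permutes[OF img that] .
  have bij: "bij_betw ?m {p. p permutes UNIV} {p. p permutes UNIV}"
  proof (rule bij_betw_byWitness[where f' = "map_permutation UNIV (inv \<iota>)"])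
    show "\<forall>p\<in>{p. p permutes UNIV}. map_permutation UNIV (inv \<iota>) (?m p) = p"
      using map_permutation_compose_inv[OF img _ ] by (auto simp: inj)
    show "\<forall>p\<in>{p. p permutes UNIV}. ?m (map_permutation UNIV (inv \<iota>) p) = p"
      using map_permutation_compose_inv[of "inv \<iota>" UNIV UNIV _ \<iota>] assms
      by (auto simp: bij_imp_bij_inv bij_is_surj surj_f_inv_f)
    show "?m ` {p. p permutes UNIV} \<subseteq> {p. p permutes UNIV}" using m by auto
    show "map_permutation UNIV (inv \<iota>) ` {p. p permutes UNIV} \<subseteq> {p. p permutes UNIV}"
      using map_permutation_permutes[of "inv \<iota>" UNIV UNIV] assms by (auto simp: bij_imp_bij_inv)
  qed
  have "det A = (\<Sum>p\<in>{p. p permutes UNIV}. of_int (sign (?m p)) * (\<Prod>i\<in>UNIV. A $ i $ ?m p i))"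
    unfolding det_def by (rule sum.reindex_bij_betw[OF bij, symmetric])
  also have "\<dots> = (\<Sum>p\<in>{p. p permutes UNIV}. of_int (sign p) * (\<Prod>k\<in>UNIV. A $ \<iota> k $ \<iota> (p k)))"
  proof (rule sum.cong[OF refl])
    fix p :: "'b \<Rightarrow> 'b" assume "p \<in> {p. p permutes UNIV}"
    then have p: "p permutes UNIV" by simp
    have "(\<Prod>i\<in>UNIV. A $ i $ ?m p i) = (\<Prod>k\<in>UNIV. A $ \<iota> k $ ?m p (\<iota> k))"
      by (rule prod.reindex_bij_betw[OF img, symmetric])
    then show "of_int (sign (?m p)) * (\<Prod>i\<in>UNIV. A $ i $ ?m p i)
        = of_int (sign p) * (\<Prod>k\<in>UNIV. A $ \<iota> k $ \<iota> (p k))"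
      using p inj by (simp add: sign_map_permutation map_permutation_apply)
  qed
  finally show ?thesis by (simp add: det_def)
qed

text \<open>The substitution formula is exact on \<open>range g\<close>. Since \<open>F\<close> is
  nonnegative, passing from the range to the whole space costs only an inequality, so surjectivity
  of \<open>g\<close> never has to be shown.\<close>

lemma change_of_variables_le_wellorder:
  fixes g :: "real^'m::{finite,wellorder} \<Rightarrow> real^'m::_"
  assumes g: "\<And>x. (g has_derivative (\<lambda>h. D x *v h)) (at x)" and "inj g"
    and F: "integrable lborel F" "\<And>x. 0 \<le> F x" and G: "integrable lborel G"
    and le: "\<And>x. G x \<le> \<bar>det (D x)\<bar> * F (g x)"
  shows "integral\<^sup>L lborel G \<le> integral\<^sup>L lborel F"
proof -
  \<comment> \<open>\<open>F\<close> is wrapped as a one-component vector, the form of integrand in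
    \<open>has_absolute_integral_change_of_variables\<close>.\<close>
  let ?v = "\<lambda>x. vec (F x) :: real^1"
  have Fa: "F absolutely_integrable_on UNIV"
    using F(1) integrable_completion[of F lborel] borel_measurable_integrable
    by (auto simp: set_integrable_def)
  have "range g \<in> sets lebesgue"
    using differentiable_image_in_sets_lebesgue[of UNIV g] g
    by (auto simp: differentiable_on_def differentiable_def)
  then have Fg: "F absolutely_integrable_on range g"
    using set_integrable_subset[OF Fa] by auto
  have v: "?v absolutely_integrable_on range g" "integral (range g) ?v = vec (integral (range g) F)"
    using Fg by (auto simp: absolutely_integrable_on_1_iff integral_on_1_eq)
  have "(\<lambda>x. \<bar>det (matrix ((*v) (D x)))\<bar> *\<^sub>R ?v (g x)) absolutely_integrable_on UNIV \<and>
      integral UNIV (\<lambda>x. \<bar>det (matrix ((*v) (D x)))\<bar> *\<^sub>R ?v (g x)) = vec (integral (range g) F)"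
    using has_absolute_integral_change_of_variables[of UNIV g "\<lambda>x. (*v) (D x)" ?v "vec (integral (range g) F)"]
      g \<open>inj g\<close> v by (simp add: matrix_of_matrix_vector_mul)
  then have D: "(\<lambda>x. \<bar>det (D x)\<bar> * F (g x)) absolutely_integrable_on UNIV"
      "integral UNIV (\<lambda>x. \<bar>det (D x)\<bar> * F (g x)) = integral (range g) F"
    by (simp_all add: absolutely_integrable_on_1_iff integral_on_1_eq vec_eq_iff)
  have "integral\<^sup>L lborel G = integral UNIV G"
    using integral_lborel[OF G] by simp
  also have "\<dots> \<le> integral UNIV (\<lambda>x. \<bar>det (D x)\<bar> * F (g x))"
    by (intro integral_le integrable_on_lborel G le set_lebesgue_integral_eq_integral(1) D(1))
  also have "\<dots> \<le> integral UNIV F"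
    unfolding D(2)
    by (intro integral_subset_le set_lebesgue_integral_eq_integral(1) Fa Fg) (use F in auto)
  also have "\<dots> = integral\<^sup>L lborel F" using integral_lborel[OF F(1)] by simp
  finally show ?thesis .
qed

lemma ex_bij_idx: "\<exists>\<iota> :: 'a::finite idx \<Rightarrow> 'a. bij \<iota>"
  using finite_same_card_bij[of "UNIV::'a idx set" "UNIV::'a set"] by (simp add: card_idx)

lemma integrable_reindex:
  fixes F :: "real^'b \<Rightarrow> real" and \<iota> :: "'b::finite \<Rightarrow> 'a::finite"
  assumes "bij \<iota>" "integrable lborel F"
  shows "integrable lborel (\<lambda>x. F (reindex \<iota> x))" "integral\<^sup>L lborel (\<lambda>x. F (reindex \<iota> x)) = integral\<^sup>L lborel F"
proof -
  have [measurable]: "F \<in> borel_measurable borel" using assms(2) by auto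
  have F: "integrable (distr lborel borel (reindex \<iota>)) F" by (simp add: distr_reindex assms)
  show "integrable lborel (\<lambda>x. F (reindex \<iota> x))"
    by (rule integrable_distr[OF _ F]) simp
  show "integral\<^sup>L lborel (\<lambda>x. F (reindex \<iota> x)) = integral\<^sup>L lborel F"
    using integral_distr[of "reindex \<iota>" lborel borel F] by (simp add: distr_reindex assms)
qed

text \<open>Conjugating \<open>g\<close> by a relabelling of coordinates changes neither the
  integrals nor the determinants, so the well-ordered case carries over.\<close>

theorem change_of_variables_le:
  fixes g :: "real^'m::finite \<Rightarrow> real^'m"
  assumes g: "\<And>x. (g has_derivative (\<lambda>h. D x *v h)) (at x)" and "inj g"
    and F: "integrable lborel F" "\<And>x. 0 \<le> F x" and G: "integrable lborel G"
    and le: "\<And>x. G x \<le> \<bar>det (D x)\<bar> * F (g x)"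
  shows "integral\<^sup>L lborel G \<le> integral\<^sup>L lborel F"
proof -
  obtain \<iota> :: "'m idx \<Rightarrow> 'm" where \<iota>: "bij \<iota>" using ex_bij_idx by blast
  have \<iota>': "bij (inv \<iota>)" using \<iota> by (rule bij_imp_bij_inv)
  let ?\<Phi> = "reindex \<iota>" and ?\<Psi> = "reindex (inv \<iota>)"
  let ?D = "\<lambda>y. \<chi> k l. D (?\<Psi> y) $ \<iota> k $ \<iota> l"
  have D: "?D y *v h = ?\<Phi> (D (?\<Psi> y) *v ?\<Psi> h)" for y h
  proof (intro vec_eq_iff[THEN iffD2] allI)
    fix k
    have "(\<Sum>l\<in>UNIV. D (?\<Psi> y) $ \<iota> k $ \<iota> l * h $ (inv \<iota> (\<iota> l))) = (\<Sum>j\<in>UNIV. D (?\<Psi> y) $ \<iota> k $ j * h $ (inv \<iota> j))"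
      by (rule sum.reindex_bij_betw[OF \<iota>])
    then show "(?D y *v h) $ k = ?\<Phi> (D (?\<Psi> y) *v ?\<Psi> h) $ k"
      using \<iota> by (simp add: reindex_def matrix_vector_mult_def bij_is_inj)
  qed
  have "integral\<^sup>L lborel (\<lambda>y. G (?\<Psi> y)) \<le> integral\<^sup>L lborel (\<lambda>y. F (?\<Psi> y))"
  proof (rule change_of_variables_le_wellorder)
    show "((\<lambda>y. ?\<Phi> (g (?\<Psi> y))) has_derivative (\<lambda>h. ?D y *v h)) (at y)" for y
    proof -
      have "((\<lambda>y. g (?\<Psi> y)) has_derivative (\<lambda>h. D (?\<Psi> y) *v ?\<Psi> h)) (at y)"
        by (rule has_derivative_compose[OF linear_imp_has_derivative[OF linear_reindex] g])
      from has_derivative_compose[OF this linear_imp_has_derivative[OF linear_reindex]]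
      show ?thesis unfolding D .
    qed
    show "inj (\<lambda>y. ?\<Phi> (g (?\<Psi> y)))"
    proof (rule injI)
      fix x y assume "?\<Phi> (g (?\<Psi> x)) = ?\<Phi> (g (?\<Psi> y))"
      then have "?\<Psi> (?\<Phi> (g (?\<Psi> x))) = ?\<Psi> (?\<Phi> (g (?\<Psi> y)))" by simp
      then have "?\<Psi> x = ?\<Psi> y" using \<open>inj g\<close> by (simp add: reindex_inverse[OF \<iota>] inj_eq)
      then have "?\<Phi> (?\<Psi> x) = ?\<Phi> (?\<Psi> y)" by simp
      then show "x = y" by (simp add: reindex_inverse[OF \<iota>])
    qed
    show "G (?\<Psi> y) \<le> \<bar>det (?D y)\<bar> * F (?\<Psi> (?\<Phi> (g (?\<Psi> y))))" for y
      using le by (simp add: det_reindex \<iota> reindex_inverse[OF \<iota>])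
    show "integrable lborel (\<lambda>y. F (?\<Psi> y))" "integrable lborel (\<lambda>y. G (?\<Psi> y))"
      by (intro integrable_reindex(1) \<iota>' F(1) G)+
  qed (rule F(2))
  then show ?thesis by (simp only: integrable_reindex(2)[OF \<iota>' F(1)] integrable_reindex(2)[OF \<iota>' G])
qed


text \<open>The one-sided change of variables, used for \<open>A\<close> and for its inverse, gives
  the two inequalities, because the two determinants multiply to 1.\<close>

lemma vol_matrix_image:
  fixes A :: "real^'n^'n"
  assumes "compact S" "invertible A"
  shows "vol ((*v) A ` S) = \<bar>det A\<bar> * vol S"
proof -
  have *: "\<bar>det A\<bar> * vol S \<le> vol ((*v) A ` S)" if "compact S" "invertible A" for A :: "real^'n^'n" and S
  proof -
    have c: "compact ((*v) A ` S)"
      by (intro compact_continuous_image linear_continuous_on that matrix_vector_mul_bounded_linear)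
    have i: "integrable lborel (indicator X :: real^'n \<Rightarrow> real)" if "compact X" for X
      using that by (intro integrable_real_indicator) (auto simp: compact_imp_closed emeasure_compact_finite[unfolded infinity_ennreal_def])
    have "integral\<^sup>L lborel (\<lambda>x. \<bar>det A\<bar> * indicator S x) \<le> integral\<^sup>L lborel (indicator ((*v) A ` S) :: real^'n \<Rightarrow> real)"
    proof (rule change_of_variables_le)
      show "((*v) A has_derivative (*v) A) (at x)" for x
        by (intro linear_imp_has_derivative) simp
      show "inj ((*v) A)" using that(2) by (simp add: inj_matrix_vector_mult)
    qed (use i[OF c] i[OF that(1)] in \<open>auto split: split_indicator intro!: integrable_mult_right\<close>)
    then show ?thesis using c that(1)
      by (simp add: measure_completion compact_imp_closed borel_closed)
  qed
  obtain B where B: "A ** B = mat 1" "B ** A = mat 1" using assms(2) by (auto simp: invertible_def)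
  have "\<bar>det B\<bar> * vol ((*v) A ` S) \<le> vol ((*v) B ` (*v) A ` S)"
  proof (rule *)
    show "invertible B" using B by (auto simp: invertible_def)
  qed (intro compact_continuous_image linear_continuous_on assms matrix_vector_mul_bounded_linear)
  also have "(*v) B ` (*v) A ` S = S"
    using assms by (simp add: image_image matrix_vector_mul_assoc B)
  finally have "\<bar>det B\<bar> * vol ((*v) A ` S) \<le> vol S" .
  moreover have "det A * det B = 1"
    using B by (metis det_I det_mul)
  then have "\<bar>det A\<bar> * \<bar>det B\<bar> = 1" by (metis abs_mult abs_one)
  ultimately have "vol ((*v) A ` S) \<le> \<bar>det A\<bar> * vol S"
    by (metis abs_ge_zero mult.assoc mult_1 mult_left_mono)
  with *[OF assms] show ?thesis by linarith
qed

section \<open>Determinants of sums of rank-one matrices\<close>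

definition outer :: "real^'n \<Rightarrow> real^'n^'n"
  where "outer u = (\<chi> i j. u $ i * u $ j)"

lemma outer_mult_vec: "outer u *v x = (u \<bullet> x) *\<^sub>R u"
  by (simp add: outer_def matrix_vector_mult_def vec_eq_iff inner_vec_def sum_distrib_left mult_ac)

lemma trace_outer: "trace (outer u) = (norm u)\<^sup>2"
  by (simp add: trace_def outer_def power2_norm_eq_inner inner_vec_def)

text \<open>Cauchy-Binet: averaging over the permutations of the index function \<open>f\<close> turns each term into a square.\<close>

lemma det_sum_outer:
  fixes S :: "(real^'n) set"
  assumes "finite S"
  shows "fact CARD('n) * det (\<Sum>u\<in>S. a u *\<^sub>R outer u)
    = (\<Sum>f | \<forall>i. f i \<in> S. (\<Prod>i\<in>UNIV. a (f i)) * (det (\<chi> i. f i))\<^sup>2)"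
proof -
  let ?F = "{f :: 'n \<Rightarrow> real^'n. \<forall>i. f i \<in> S}"
  let ?M = "\<Sum>u\<in>S. a u *\<^sub>R outer u"
  have F: "?F = PiE UNIV (\<lambda>_. S)" by (auto simp: PiE_def Pi_def)
  have d: "det ?M = (\<Sum>f\<in>?F. (\<Prod>i\<in>UNIV. a (f i)) * (\<Prod>i\<in>UNIV. f i $ i) * det (\<chi> i. f i))"
  proof -
    have "det ?M = (\<Sum>p | p permutes (UNIV :: 'n set). of_int (sign p) *
        (\<Prod>i\<in>UNIV. \<Sum>u\<in>S. a u * (u $ i * u $ p i)))"
      by (simp add: det_def sum_component outer_def)
    also have "\<dots> = (\<Sum>p | p permutes (UNIV :: 'n set). of_int (sign p) *
        (\<Sum>f\<in>?F. \<Prod>i\<in>UNIV. a (f i) * (f i $ i * f i $ p i)))"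
      unfolding F by (subst prod_sum_PiE) (simp_all add: assms)
    also have "\<dots> = (\<Sum>f\<in>?F. \<Sum>p | p permutes (UNIV :: 'n set). of_int (sign p) *
        (\<Prod>i\<in>UNIV. a (f i) * (f i $ i * f i $ p i)))"
      by (subst sum.swap) (simp add: sum_distrib_left)
    finally show ?thesis
      by (simp add: det_def prod.distrib sum_distrib_left mult_ac)
  qed
  \<comment> \<open>Precomposing the index functions with \<open>p\<close> permutes the range of
    summation. The product of the coefficients is unchanged and the determinant picks up the sign of
    \<open>p\<close>.\<close>
  have perm: "det ?M = (\<Sum>f\<in>?F. (\<Prod>i\<in>UNIV. a (f i)) * (of_int (sign p) * (\<Prod>i\<in>UNIV. f (p i) $ i)) * det (\<chi> i. f i))"
    if p: "p permutes (UNIV :: 'n set)" for p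
  proof -
    have bij: "bij_betw (\<lambda>f. f \<circ> p) ?F ?F"
      by (rule bij_betw_byWitness[where f' = "\<lambda>f. f \<circ> inv p"])
         (use permutes_inv_o[OF p] in \<open>auto simp: o_assoc[symmetric]\<close>)
    have "(\<Prod>i\<in>UNIV. a (f (p i))) = (\<Prod>i\<in>UNIV. a (f i))" for f :: "'n \<Rightarrow> real^'n"
      by (rule prod.reindex_bij_betw) (use p permutes_bij in blast)
    moreover have "det (\<chi> i. f (p i)) = of_int (sign p) * det (\<chi> i. f i)" for f :: "'n \<Rightarrow> real^'n"
      using det_permute_rows[OF p, of "\<chi> i. f i"] by simp
    ultimately show ?thesis
      unfolding d by (subst sum.reindex_bij_betw[OF bij, symmetric]) (simp add: o_def mult_ac)
  qed
  \<comment> \<open>Summed over \<open>p\<close>, the signed products form a second determinant,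
    which supplies the other factor of the square.\<close>
  have T: "det (transpose (\<chi> i. f i)) = (\<Sum>p | p permutes (UNIV :: 'n set). of_int (sign p) * (\<Prod>i\<in>UNIV. f (p i) $ i))"
    for f :: "'n \<Rightarrow> real^'n"
    by (simp add: det_def transpose_def)
  have "fact CARD('n) * det ?M = (\<Sum>p | p permutes (UNIV :: 'n set). det ?M)"
    using card_permutations[of "UNIV :: 'n set"] by simp
  also have "\<dots> = (\<Sum>p | p permutes (UNIV :: 'n set).
      \<Sum>f\<in>?F. (\<Prod>i\<in>UNIV. a (f i)) * (of_int (sign p) * (\<Prod>i\<in>UNIV. f (p i) $ i)) * det (\<chi> i. f i))"
    by (rule sum.cong[OF refl], rule perm) simp
  also have "\<dots> = (\<Sum>f\<in>?F. (\<Prod>i\<in>UNIV. a (f i)) * det (transpose (\<chi> i. f i)) * det (\<chi> i. f i))"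
    unfolding T by (subst sum.swap) (simp add: sum_distrib_left sum_distrib_right)
  finally show ?thesis by (simp add: det_transpose power2_eq_square mult_ac)
qed

text \<open>A permutation other than the identity moves at least two indices. After one entry is
  differentiated, its Leibniz term still contains an off-diagonal entry of the identity matrix, so
  only the diagonal term survives.\<close>

lemma has_real_derivative_det:
  fixes A :: "real \<Rightarrow> real^'n^'n"
  assumes "A 0 = mat 1" and A: "\<And>i j. ((\<lambda>t. A t $ i $ j) has_real_derivative A' $ i $ j) (at 0)"
  shows "((\<lambda>t. det (A t)) has_real_derivative trace A') (at 0)"
proof -
  let ?P = "{p. p permutes (UNIV :: 'n set)}"
  have "((\<lambda>t. det (A t)) has_real_derivative
      (\<Sum>p\<in>?P. of_int (sign p) * (\<Sum>i\<in>UNIV. A' $ i $ p i * (\<Prod>j\<in>UNIV - {i}. A 0 $ j $ p j)))) (at 0)"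
    unfolding det_def by (intro DERIV_sum DERIV_cmult has_field_derivative_prod A)
  also have "(\<Sum>p\<in>?P. of_int (sign p) * (\<Sum>i\<in>UNIV. A' $ i $ p i * (\<Prod>j\<in>UNIV - {i}. A 0 $ j $ p j)))
      = (\<Sum>p\<in>{id}. of_int (sign p) * (\<Sum>i\<in>UNIV. A' $ i $ p i * (\<Prod>j\<in>UNIV - {i}. A 0 $ j $ p j)))"
  proof (rule sum.mono_neutral_right)
    show "\<forall>p\<in>?P - {id}. of_int (sign p) * (\<Sum>i\<in>UNIV. A' $ i $ p i * (\<Prod>j\<in>UNIV - {i}. A 0 $ j $ p j)) = 0"
    proof
      fix p assume p: "p \<in> ?P - {id}"
      have "(\<Prod>j\<in>UNIV - {i}. A 0 $ j $ p j) = 0" for i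
      proof -
        obtain j where j: "p j \<noteq> j" using p by (auto simp: fun_eq_iff)
        have "p (p j) \<noteq> p j" using p j permutes_inj[of p UNIV] by (auto simp: inj_eq)
        then obtain k where "k \<noteq> i" "p k \<noteq> k" using j by metis
        then show ?thesis by (intro prod_zero bexI[of _ k]) (auto simp: assms(1) mat_def)
      qed
      then show "of_int (sign p) * (\<Sum>i\<in>UNIV. A' $ i $ p i * (\<Prod>j\<in>UNIV - {i}. A 0 $ j $ p j)) = 0"
        by (simp only: mult_zero_right sum.neutral_const)
    qed
  qed (auto simp: permutes_id finite_permutations)
  also have "\<dots> = trace A'" by (simp add: assms(1) mat_def trace_def sign_id)
  finally show ?thesis .
qed

lemma sum_outer_eq_mat:
  assumes "\<And>x. (\<Sum>u\<in>S. (c u * (u \<bullet> x)) *\<^sub>R u) = x"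
  shows "(\<Sum>u\<in>S. c u *\<^sub>R outer u) = mat 1"
proof -
  have "(\<Sum>u\<in>S. c u *\<^sub>R outer u) *v x = (\<Sum>u\<in>S. (c u * (u \<bullet> x)) *\<^sub>R u)" for x
    by (induction S rule: infinite_finite_induct)
      (simp_all add: matrix_vector_mult_add_rdistrib scaleR_matrix_vector_assoc[symmetric] outer_mult_vec)
  then have "(\<Sum>u\<in>S. c u *\<^sub>R outer u) *v x = x" for x using assms by simp
  then show ?thesis by (simp add: matrix_eq)
qed

text \<open>By the preceding expansion, \<open>\<Phi> r = det (\<Sum> c\<^sub>u t\<^sub>u\<^sup>r u\<otimes>u)\<close> is an average of exponentials \<open>exp (r * L f)\<close>,
  and its derivative at \<open>0\<close> identifies the mean of \<open>L\<close>; then apply Jensen's inequality.\<close>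

theorem ball_determinant_inequality:
  fixes S :: "(real^'n) set"
  assumes "finite S" and unit: "\<And>u. u \<in> S \<Longrightarrow> norm u = 1" and c: "\<And>u. u \<in> S \<Longrightarrow> 0 \<le> c u"
    and dec: "(\<Sum>u\<in>S. c u *\<^sub>R outer u) = mat 1" and t: "\<And>u. u \<in> S \<Longrightarrow> 0 < t u"
  shows "exp (\<Sum>u\<in>S. c u * ln (t u)) \<le> det (\<Sum>u\<in>S. (c u * t u) *\<^sub>R outer u)"
proof -
  let ?F = "{f :: 'n \<Rightarrow> real^'n. \<forall>i. f i \<in> S}"
  define W where "W f = (\<Prod>i\<in>UNIV. c (f i)) * (det (\<chi> i. f i))\<^sup>2 / fact CARD('n)" for f :: "'n \<Rightarrow> real^'n"
  define L where "L f = (\<Sum>i\<in>UNIV. ln (t (f i)))" for f :: "'n \<Rightarrow> real^'n"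
  define m where "m = (\<Sum>u\<in>S. c u * ln (t u))"
  define \<Phi> where "\<Phi> r = det (\<Sum>u\<in>S. (c u * exp (r * ln (t u))) *\<^sub>R outer u)" for r
  have \<Phi>: "\<Phi> r = (\<Sum>f\<in>?F. W f * exp (r * L f))" for r
  proof -
    have "fact CARD('n) * \<Phi> r = (\<Sum>f\<in>?F. fact CARD('n) * (W f * exp (r * L f)))"
      unfolding \<Phi>_def det_sum_outer[OF \<open>finite S\<close>]
      by (rule sum.cong[OF refl]) (simp add: W_def L_def prod.distrib exp_sum sum_distrib_left mult_ac)
    then show ?thesis by (simp add: sum_distrib_left[symmetric])
  qed
  have sumW: "(\<Sum>f\<in>?F. W f) = 1"
    using \<Phi>[of 0] dec by (simp add: \<Phi>_def)
  have "(\<Phi> has_real_derivative trace (\<Sum>u\<in>S. (c u * ln (t u)) *\<^sub>R outer u)) (at 0)"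
    unfolding \<Phi>_def
  proof (rule has_real_derivative_det)
    show "((\<lambda>r. (\<Sum>u\<in>S. (c u * exp (r * ln (t u))) *\<^sub>R outer u) $ i $ j) has_real_derivative
        (\<Sum>u\<in>S. (c u * ln (t u)) *\<^sub>R outer u) $ i $ j) (at 0)" for i j
      unfolding sum_component vector_scaleR_component
      by (auto intro!: derivative_eq_intros simp: mult_ac)
  qed (simp add: dec)
  also have "trace (\<Sum>u\<in>S. (c u * ln (t u)) *\<^sub>R outer u) = (\<Sum>u\<in>S. (c u * ln (t u)) * trace (outer u))"
    by (simp add: trace_def sum_component sum.swap[of _ UNIV] sum_distrib_left)
  also have "\<dots> = m" unfolding m_def
    by (rule sum.cong[OF refl]) (simp add: trace_outer unit)
  finally have 1: "(\<Phi> has_real_derivative m) (at 0)" .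
  have "(\<Phi> has_real_derivative (\<Sum>f\<in>?F. W f * L f)) (at 0)"
    unfolding \<Phi>[abs_def] by (auto intro!: derivative_eq_intros simp: mult_ac)
  with 1 have m: "(\<Sum>f\<in>?F. W f * L f) = m" using DERIV_unique by blast
  \<comment> \<open>Jensen's inequality by hand: the tangent of exp at the mean \<open>m\<close>
    lies below exp, and its average against the weights \<open>W\<close> is exactly
    \<open>exp m\<close>.\<close>
  have "exp m = exp m * (\<Sum>f\<in>?F. W f * (1 + L f - m))"
    using sumW m by (simp add: algebra_simps sum.distrib sum_subtractf sum_distrib_left[symmetric])
  also have "\<dots> = (\<Sum>f\<in>?F. W f * (exp m * (1 + (L f - m))))"
    by (simp add: sum_distrib_left mult_ac add_diff_eq)
  also have "\<dots> \<le> (\<Sum>f\<in>?F. W f * exp (1 * L f))"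
  proof (rule sum_mono)
    fix f assume f: "f \<in> ?F"
    have "exp m * (1 + (L f - m)) \<le> exp m * exp (L f - m)"
      by (intro mult_left_mono exp_ge_add_one_self) auto
    also have "\<dots> = exp (1 * L f)" by (simp add: exp_add[symmetric])
    finally show "W f * (exp m * (1 + (L f - m))) \<le> W f * exp (1 * L f)"
      using f c by (intro mult_left_mono) (auto simp: W_def intro!: divide_nonneg_pos mult_nonneg_nonneg prod_nonneg)
  qed
  also have "\<dots> = \<Phi> 1" by (simp add: \<Phi>)
  also have "\<dots> = det (\<Sum>u\<in>S. (c u * t u) *\<^sub>R outer u)"
    unfolding \<Phi>_def by (rule arg_cong[where f = det], rule sum.cong[OF refl]) (simp add: t)
  finally show ?thesis by (simp add: m_def)
qed

section \<open>Barthe's reverse Brascamp-Lieb inequality\<close>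

definition gauss :: "'a::euclidean_space \<Rightarrow> real"
  where "gauss y = (\<Prod>b\<in>Basis. std_normal_density (y \<bullet> b))"

lemma gauss_eq: "gauss (y::'a::euclidean_space) = exp (- (y \<bullet> y) / 2) / sqrt (2 * pi) ^ DIM('a)"
proof -
  have "gauss y = (\<Prod>b\<in>Basis. exp (- (y \<bullet> b)\<^sup>2 / 2)) / sqrt (2 * pi) ^ DIM('a)"
    by (simp add: gauss_def normal_density_def prod_dividef)
  also have "(\<Prod>b\<in>Basis. exp (- (y \<bullet> b)\<^sup>2 / 2)) = exp (- (y \<bullet> y) / 2)"
    by (simp add: exp_sum[symmetric] sum_negf sum_divide_distrib[symmetric] euclidean_inner[of y y] power2_eq_square)
  finally show ?thesis .
qed

lemma gauss_integral:
  shows integrable_gauss: "integrable lborel (gauss :: 'a::euclidean_space \<Rightarrow> real)"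
    and integral_gauss: "integral\<^sup>L lborel (gauss :: 'a::euclidean_space \<Rightarrow> real) = 1"
proof -
  have "(\<integral>\<^sup>+ y. ennreal (gauss (y::'a)) \<partial>lborel) = (\<integral>\<^sup>+ (y::'a). (\<Prod>b\<in>Basis. ennreal (std_normal_density (y \<bullet> b))) \<partial>lborel)"
    by (simp add: gauss_def prod_ennreal)
  also have "\<dots> = (\<Prod>b\<in>(Basis::'a set). (\<integral>\<^sup>+ t. ennreal (std_normal_density t) \<partial>lborel))"
    by (subst nn_integral_lborel_prod[of "\<lambda>b t. ennreal (std_normal_density t)"]) auto
  also have "\<dots> = 1"
    by (subst nn_integral_eq_integral) auto
  finally have *: "(\<integral>\<^sup>+ y. ennreal (gauss (y::'a)) \<partial>lborel) = ennreal 1" by simp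
  have [measurable]: "(gauss :: 'a \<Rightarrow> real) \<in> borel_measurable borel"
    unfolding gauss_def by measurable
  have nn: "0 \<le> gauss (y::'a)" for y
    by (auto simp: gauss_def intro!: prod_nonneg)
  show "integrable lborel (gauss :: 'a \<Rightarrow> real)"
    using * nn by (intro integrableI_nonneg) auto
  show "integral\<^sup>L lborel (gauss :: 'a \<Rightarrow> real) = 1"
    using * nn by (subst integral_eq_nn_integral) auto
qed

definition gcdf :: "real \<Rightarrow> real"
  where "gcdf t = integral {..t} std_normal_density"

lemma std_normal_has_integral: "(std_normal_density has_integral 1) UNIV"
  using has_integral_integral_lborel[of std_normal_density] by simp

lemma std_normal_integrable_on:
  assumes "S \<in> sets lebesgue"
  shows "std_normal_density absolutely_integrable_on S" "std_normal_density integrable_on S"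
proof -
  have "std_normal_density absolutely_integrable_on UNIV"
    using integrable_completion[of std_normal_density lborel] by (auto simp: set_integrable_def)
  then show "std_normal_density absolutely_integrable_on S"
    using set_integrable_subset assms by blast
  then show "std_normal_density integrable_on S"
    by (rule set_lebesgue_integral_eq_integral(1))
qed

text \<open>Cutting the half-line at \<open>t - 1\<close> leaves a constant plus an integral over a
  compact interval around \<open>t\<close>, to which the fundamental theorem applies.\<close>

lemma DERIV_gcdf: "(gcdf has_real_derivative std_normal_density t) (at t)"
proof -
  have split: "gcdf x = gcdf (t - 1) + integral {t - 1..x} std_normal_density" if "x \<in> {t - 1..t + 1}" for x
  proof -
    have "{..x} = {..t-1} \<union> {t-1..x}" using that by auto
    moreover have "negligible ({..t-1} \<inter> {t-1..x})"
      by (rule negligible_subset[of "{t-1}"]) auto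
    ultimately show ?thesis
      by (auto simp: gcdf_def intro!: integral_Un std_normal_integrable_on)
  qed
  have "((\<lambda>x. integral {t - 1..x} std_normal_density) has_real_derivative std_normal_density t) (at t within {t - 1..t + 1})"
    by (rule integral_has_real_derivative) (auto intro!: continuous_intros simp: normal_density_def)
  then have "((\<lambda>x. gcdf (t - 1) + integral {t - 1..x} std_normal_density) has_real_derivative std_normal_density t) (at t within {t - 1..t + 1})"
    by (auto intro!: derivative_eq_intros)
  then have "(gcdf has_real_derivative std_normal_density t) (at t within {t - 1..t + 1})"
    by (rule has_field_derivative_transform_within[of _ _ _ _ 1]) (simp_all only: split, simp_all)
  then show ?thesis by (subst (asm) at_within_Icc_at) auto
qed

lemma gcdf_less: "x < y \<Longrightarrow> gcdf x < gcdf y"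
  using DERIV_gcdf normal_density_pos[of 1] by (intro DERIV_pos_imp_increasing[of x y gcdf]) auto

lemma gcdf_pos: "0 < gcdf t"
proof -
  have "0 \<le> gcdf (t - 1)" unfolding gcdf_def
    by (rule integral_nonneg[OF std_normal_integrable_on(2)]) auto
  also have "\<dots> < gcdf t" by (rule gcdf_less) simp
  finally show ?thesis .
qed

lemma gcdf_less_1: "gcdf t < 1"
proof -
  have "gcdf t < gcdf (t + 1)" by (rule gcdf_less) simp
  also have "\<dots> \<le> integral UNIV std_normal_density" unfolding gcdf_def
    by (rule integral_subset_le) (auto intro!: std_normal_integrable_on)
  finally show ?thesis using std_normal_has_integral by (simp add: integral_unique)
qed

lemma gcdf_0: "gcdf 0 = 1 / 2"
proof -
  have "integral {..0} (\<lambda>x. std_normal_density (- x)) = integral {0..} std_normal_density"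
    using has_absolute_integral_reflect_real[of "{..0}" "{0..}" std_normal_density] std_normal_integrable_on[of "{0..}"]
    by (auto simp: image_subset_iff)
  moreover have "std_normal_density (- x) = std_normal_density x" for x
    by (simp add: normal_density_def)
  ultimately have "gcdf 0 = integral {0..} std_normal_density"
    by (simp only: gcdf_def)
  moreover have "integral ({..0} \<union> {0..}) std_normal_density = integral {..0} std_normal_density + integral {0..} std_normal_density"
  proof (rule integral_Un)
    show "negligible ({..0::real} \<inter> {0..})" by (rule negligible_subset[of "{0}"]) auto
  qed (auto intro!: std_normal_integrable_on)
  moreover have "{..0} \<union> {0..} = (UNIV :: real set)" by auto
  ultimately show ?thesis using std_normal_has_integral by (simp add: integral_unique gcdf_def)
qed

text \<open>Take traces in the decomposition of the identity: every unit vector contributes a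
  rank-one matrix of trace 1.\<close>

lemma sum_isotropic_weights:
  fixes S :: "(real^'m) set"
  assumes unit: "\<And>u. u \<in> S \<Longrightarrow> norm u = 1"
    and iso: "\<And>x. (\<Sum>u\<in>S. (c u * (u \<bullet> x)) *\<^sub>R u) = x"
  shows "(\<Sum>u\<in>S. c u) = CARD('m)"
proof -
  have "(\<Sum>u\<in>S. c u) = (\<Sum>u\<in>S. c u * trace (outer u))"
    by (rule sum.cong[OF refl]) (simp add: trace_outer unit)
  also have "\<dots> = trace (\<Sum>u\<in>S. c u *\<^sub>R outer u)"
    by (simp add: trace_def sum_component sum.swap[of _ UNIV] sum_distrib_left)
  also have "\<dots> = CARD('m)" by (simp add: sum_outer_eq_mat[OF iso] trace_def mat_def)
  finally show ?thesis .
qed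

text \<open>Here \<open>T\<close> transports \<open>\<kappa>\<close> times the Gaussian to the density \<open>exp (- \<rho>)\<close>, with \<open>\<rho>\<close> expressed in the
  source variable. The proof substitutes \<open>x = \<Sum> c\<^sub>u T (u \<bullet> y) u\<close>.\<close>

theorem barthe_inequality:
  fixes S :: "(real^'m) set"
  assumes "finite S" and unit: "\<And>u. u \<in> S \<Longrightarrow> norm u = 1" and c: "\<And>u. u \<in> S \<Longrightarrow> 0 \<le> c u"
    and iso: "\<And>x. (\<Sum>u\<in>S. (c u * (u \<bullet> x)) *\<^sub>R u) = x"
    and T: "\<And>t. (T has_real_derivative T' t) (at t)" and T': "\<And>t. 0 < T' t"
    and \<rho>: "\<And>t. exp (- \<rho> t) * T' t = \<kappa> * std_normal_density t" and "0 < \<kappa>"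
    and F: "integrable lborel F" "\<And>x. 0 \<le> F x"
    and le: "\<And>y. exp (- (\<Sum>u\<in>S. c u * \<rho> (u \<bullet> y))) \<le> F (\<Sum>u\<in>S. (c u * T (u \<bullet> y)) *\<^sub>R u)"
  shows "\<kappa> ^ CARD('m) \<le> integral\<^sup>L lborel F"
proof -
  define g where "g y = (\<Sum>u\<in>S. (c u * T (u \<bullet> y)) *\<^sub>R u)" for y
  define D where "D y = (\<Sum>u\<in>S. (c u * T' (u \<bullet> y)) *\<^sub>R outer u)" for y
  have dec: "(\<Sum>u\<in>S. c u *\<^sub>R outer u) = mat 1" by (rule sum_outer_eq_mat[OF iso])
  have sumc: "(\<Sum>u\<in>S. c u) = CARD('m)" by (rule sum_isotropic_weights[OF unit iso])
  \<comment> \<open>Pairing the isotropy relation with \<open>y\<close> gives a Parseval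
    identity.\<close>
  have sumsq: "(\<Sum>u\<in>S. c u * (u \<bullet> y)\<^sup>2) = y \<bullet> y" for y
    using arg_cong[OF iso[of y], of "\<lambda>z. z \<bullet> y"] by (simp add: inner_sum_left power2_eq_square mult_ac)
  have "integral\<^sup>L lborel (\<lambda>y::real^'m. \<kappa> ^ CARD('m) * gauss y) \<le> integral\<^sup>L lborel F"
  proof (rule change_of_variables_le[OF _ _ F])
    fix y
    have "(g has_derivative (\<lambda>h. \<Sum>u\<in>S. (c u * (T' (u \<bullet> y) * (u \<bullet> h))) *\<^sub>R u)) (at y)"
      unfolding g_def
      by (intro has_derivative_sum has_derivative_scaleR_left has_derivative_mult_right
          has_derivative_compose[of "\<lambda>y. u \<bullet> y" for u, OF has_derivative_inner_right[OF has_derivative_ident]]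
          T[unfolded has_field_derivative_def])
    moreover have "(\<Sum>u\<in>S. (c u * (T' (u \<bullet> y) * (u \<bullet> h))) *\<^sub>R u) = D y *v h" for h
      unfolding D_def
      by (induction S rule: infinite_finite_induct)
        (simp_all add: matrix_vector_mult_add_rdistrib scaleR_matrix_vector_assoc[symmetric] outer_mult_vec mult_ac)
    ultimately show "(g has_derivative (\<lambda>h. D y *v h)) (at y)" by simp
    \<comment> \<open>The logarithm of the transport equation is affine in the square of its
      argument. Weighted by \<open>c\<close>, the constants add up through \<open>sumc\<close> and
      the squares through \<open>sumsq\<close>, so exactly the Gaussian in dimension m
      appears.\<close>
    have "exp (- (\<Sum>u\<in>S. c u * \<rho> (u \<bullet> y))) * exp (\<Sum>u\<in>S. c u * ln (T' (u \<bullet> y)))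
        = exp (\<Sum>u\<in>S. c u * (ln (\<kappa> / sqrt (2 * pi)) - (u \<bullet> y)\<^sup>2 / 2))"
      unfolding exp_add[symmetric]
    proof (rule arg_cong[where f = exp])
      have "ln (T' t) - \<rho> t = ln (\<kappa> / sqrt (2 * pi)) - t\<^sup>2 / 2" for t
      proof -
        have "ln (exp (- \<rho> t) * T' t) = ln (\<kappa> / sqrt (2 * pi) * exp (- t\<^sup>2 / 2))"
          by (simp add: \<rho> normal_density_def)
        also have "\<dots> = ln (\<kappa> / sqrt (2 * pi)) - t\<^sup>2 / 2"
          using \<open>0 < \<kappa>\<close> by (subst ln_mult) auto
        finally show ?thesis using T'[of t] by (simp add: ln_mult)
      qed
      from this[symmetric] show "- (\<Sum>u\<in>S. c u * \<rho> (u \<bullet> y)) + (\<Sum>u\<in>S. c u * ln (T' (u \<bullet> y)))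
        = (\<Sum>u\<in>S. c u * (ln (\<kappa> / sqrt (2 * pi)) - (u \<bullet> y)\<^sup>2 / 2))"
        by (simp add: right_diff_distrib sum_subtractf)
    qed
    also have "(\<Sum>u\<in>S. c u * (ln (\<kappa> / sqrt (2 * pi)) - (u \<bullet> y)\<^sup>2 / 2)) = CARD('m) * ln (\<kappa> / sqrt (2 * pi)) - (y \<bullet> y) / 2"
      by (simp add: right_diff_distrib sum_subtractf sum_distrib_right[symmetric] sumc sum_divide_distrib[symmetric] sumsq)
    also have "exp \<dots> = exp (ln (\<kappa> / sqrt (2 * pi))) ^ CARD('m) * exp (- (y \<bullet> y) / 2)"
      by (simp only: exp_of_nat_mult[symmetric] exp_add[symmetric]) simp
    also have "exp (ln (\<kappa> / sqrt (2 * pi))) = \<kappa> / sqrt (2 * pi)"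
      using \<open>0 < \<kappa>\<close> by simp
    also have "(\<kappa> / sqrt (2 * pi)) ^ CARD('m) * exp (- (y \<bullet> y) / 2) = \<kappa> ^ CARD('m) * gauss y"
      by (simp add: gauss_eq power_divide)
    finally have "\<kappa> ^ CARD('m) * gauss y
      = exp (\<Sum>u\<in>S. c u * ln (T' (u \<bullet> y))) * exp (- (\<Sum>u\<in>S. c u * \<rho> (u \<bullet> y)))" by (simp add: mult.commute)
    also have "\<dots> \<le> \<bar>det (D y)\<bar> * F (g y)"
    proof (rule mult_mono)
      show "exp (\<Sum>u\<in>S. c u * ln (T' (u \<bullet> y))) \<le> \<bar>det (D y)\<bar>"
        unfolding D_def using ball_determinant_inequality[OF \<open>finite S\<close> unit c dec, of "\<lambda>u. T' (u \<bullet> y)"] T' by force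
    qed (use le in \<open>auto simp: g_def\<close>)
    finally show "\<kappa> ^ CARD('m) * gauss y \<le> \<bar>det (D y)\<bar> * F (g y)" .
  next
    \<comment> \<open>\<open>T\<close> is strictly increasing, so the inner product of
      \<open>g x - g y\<close> with \<open>x - y\<close> is a sum of nonnegative terms. If it
      vanishes, every \<open>u\<close> of nonzero weight is orthogonal to \<open>x - y\<close>, and
      isotropy gives \<open>x = y\<close>.\<close>
    show "inj g"
    proof (rule injI)
      fix x y assume "g x = g y"
      have mono: "a < b \<Longrightarrow> T a < T b" for a b
        using T T' by (intro DERIV_pos_imp_increasing[of a b T]) auto
      have nn: "0 \<le> (T a - T b) * (a - b)" for a b
        using mono[of a b] mono[of b a] by (cases a b rule: linorder_cases) (auto simp: mult_nonneg_nonneg mult_nonpos_nonpos)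
      have "(\<Sum>u\<in>S. c u * ((T (u \<bullet> x) - T (u \<bullet> y)) * (u \<bullet> x - u \<bullet> y))) = (g x - g y) \<bullet> (x - y)"
        by (simp add: g_def sum_subtractf[symmetric] inner_sum_left inner_diff_right algebra_simps)
      also have "\<dots> = 0" by (simp add: \<open>g x = g y\<close>)
      finally have *: "\<forall>u\<in>S. c u * ((T (u \<bullet> x) - T (u \<bullet> y)) * (u \<bullet> x - u \<bullet> y)) = 0"
        by (subst (asm) sum_nonneg_eq_0_iff) (auto intro!: mult_nonneg_nonneg nn c \<open>finite S\<close>)
      have "c u * (u \<bullet> (x - y)) = 0" if "u \<in> S" for u
      proof -
        have "c u = 0 \<or> T (u \<bullet> x) = T (u \<bullet> y) \<or> u \<bullet> x = u \<bullet> y" using * that by auto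
        then show ?thesis using mono[of "u \<bullet> x" "u \<bullet> y"] mono[of "u \<bullet> y" "u \<bullet> x"]
          by (auto simp: inner_diff_right) (meson less_irrefl linorder_less_linear)
      qed
      then have "(\<Sum>u\<in>S. (c u * (u \<bullet> (x - y))) *\<^sub>R u) = 0"
        by (intro sum.neutral ballI) (simp only: scaleR_zero_left)
      then show "x = y" by (simp add: iso)
    qed
  qed (intro integrable_mult_right integrable_gauss)
  then show ?thesis by (simp add: integral_gauss)
qed

section \<open>Transport maps to the exponential and the Laplace density\<close>

text \<open>Equating upper tails determines the map: \<open>exp (- T t)\<close> must be the Gaussian
  mass beyond \<open>t\<close>, which is \<open>gcdf (- t)\<close> by symmetry. The exponent is
  \<open>T\<close> itself, and both masses are 1.\<close>

lemma exponential_transport: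
  obtains T T' :: "real \<Rightarrow> real"
  where "\<And>t. (T has_real_derivative T' t) (at t)" "\<And>t. 0 < T' t" "\<And>t. 0 < T t"
    "\<And>t. exp (- T t) * T' t = 1 * std_normal_density t"
proof
  show "((\<lambda>t. - ln (gcdf (- t))) has_real_derivative std_normal_density t / gcdf (- t)) (at t)" for t
  proof -
    have "((\<lambda>t. gcdf (- t)) has_real_derivative - std_normal_density (- t)) (at t)"
      using DERIV_chain2[OF DERIV_gcdf DERIV_minus[OF DERIV_ident]] by simp
    then show ?thesis using gcdf_pos[of "-t"]
      by (auto intro!: derivative_eq_intros simp: normal_density_def)
  qed
  show "0 < std_normal_density t / gcdf (- t)" for t
    by (intro divide_pos_pos normal_density_pos gcdf_pos) simp
  show "0 < - ln (gcdf (- t))" for t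
    using gcdf_pos gcdf_less_1 by simp
  show "exp (- (- ln (gcdf (- t)))) * (std_normal_density t / gcdf (- t)) = 1 * std_normal_density t" for t
    using gcdf_pos[of "- t"] by simp
qed

text \<open>The density exp of minus the absolute value has total mass 2, hence the factor 2.
  Equating lower tails gives \<open>exp (T t) = 2 * gcdf t\<close> for negative \<open>t\<close>,
  and the other half follows by oddness.\<close>

lemma laplace_transport:
  obtains T T' :: "real \<Rightarrow> real"
  where "\<And>t. (T has_real_derivative T' t) (at t)" "\<And>t. 0 < T' t"
    "\<And>t. exp (- \<bar>T t\<bar>) * T' t = 2 * std_normal_density t"
proof
  let ?T = "\<lambda>t. if t \<le> 0 then ln (2 * gcdf t) else - ln (2 * gcdf (- t))"
  let ?T' = "\<lambda>t. std_normal_density t / gcdf (- \<bar>t\<bar>)"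
  have 1: "((\<lambda>t. ln (2 * gcdf t)) has_real_derivative std_normal_density t / gcdf t) (at t within A)" for t A
    using gcdf_pos[of t] DERIV_gcdf[THEN DERIV_subset]
    by (auto intro!: derivative_eq_intros)
  have 2: "((\<lambda>t. - ln (2 * gcdf (- t))) has_real_derivative std_normal_density t / gcdf (- t)) (at t within A)" for t A
  proof -
    have "((\<lambda>t. gcdf (- t)) has_real_derivative - std_normal_density (- t)) (at t)"
      using DERIV_chain2[OF DERIV_gcdf DERIV_minus[OF DERIV_ident]] by simp
    then have "((\<lambda>t. - ln (2 * gcdf (- t))) has_real_derivative std_normal_density t / gcdf (- t)) (at t)"
      using gcdf_pos[of "-t"]
      by (auto intro!: derivative_eq_intros simp: normal_density_def)
    then show ?thesis by (rule DERIV_subset) simp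
  qed
  show "(?T has_real_derivative ?T' t) (at t)" for t
  proof -
    \<comment> \<open>The branches fit together at 0: \<open>gcdf 0 = 1 / 2\<close> makes both
      values 0 and both slopes equal.\<close>
    have "(?T has_vector_derivative (if t \<in> {..0} then std_normal_density t / gcdf t else std_normal_density t / gcdf (- t))) (at t)"
      using has_vector_derivative_If_within_closures[of t "{..0}" "{0..}" UNIV "\<lambda>t. ln (2 * gcdf t)"
          "\<lambda>t. std_normal_density t / gcdf t" "\<lambda>t. - ln (2 * gcdf (- t))" "\<lambda>t. std_normal_density t / gcdf (- t)"]
        1[unfolded has_real_derivative_iff_has_vector_derivative] 2[unfolded has_real_derivative_iff_has_vector_derivative]
      by (force simp: gcdf_0)
    then show ?thesis
      by (auto simp: has_real_derivative_iff_has_vector_derivative split: if_splits)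
  qed
  show "0 < ?T' t" for t by (intro divide_pos_pos normal_density_pos gcdf_pos) simp
  show "exp (- \<bar>?T t\<bar>) * ?T' t = 2 * std_normal_density t" for t
  proof -
    have "2 * gcdf s \<le> 1" if "s \<le> 0" for s
      using gcdf_less[of s 0] that by (cases "s = 0") (auto simp: gcdf_0)
    then have *: "exp (- \<bar>ln (2 * gcdf s)\<bar>) = 2 * gcdf s" if "s \<le> 0" for s
      using gcdf_pos[of s] that by (simp add: abs_of_nonpos)
    show ?thesis using *[of t] *[of "- t"] gcdf_pos[of t] gcdf_pos[of "- t"] by auto
  qed
qed

section \<open>The Loewner ellipsoid and John's theorem\<close>

text \<open>The pair \<open>(M, b)\<close> stands for the ellipsoid \<open>{x. \<bar>M x - b\<bar> \<le> 1}\<close>, of volume \<open>\<omega>\<^sub>n / \<bar>det M\<bar>\<close>. In these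
  coordinates the ellipsoids containing \<open>K\<close> form a compact set, and the Loewner ellipsoid maximizes
  \<open>\<bar>det M\<bar>\<close>.\<close>

definition admissible :: "(real^'n) set \<Rightarrow> ((real^'n^'n) \<times> (real^'n)) set"
  where "admissible K = {(M, b). \<forall>x\<in>K. norm (M *v x - b) \<le> 1}"

text \<open>The constraint at the origin bounds \<open>b\<close>. Subtracting the constraints at
  opposite points of the small ball eliminates \<open>b\<close> and bounds one column of
  \<open>M\<close>.\<close>

lemma admissible_bounded:
  fixes K :: "(real^'n) set"
  assumes "0 < r" "cball 0 r \<subseteq> K" "(M, b) \<in> admissible K"
  shows "norm b \<le> 1" "\<bar>M $ i $ j\<bar> \<le> 1 / r"
proof -
  have adm: "norm (M *v x - b) \<le> 1" if "norm x \<le> r" for x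
    using assms(2,3) that by (auto simp: admissible_def)
  show "norm b \<le> 1" using adm[of 0] \<open>0 < r\<close> by simp
  let ?x = "r *\<^sub>R axis j 1 :: real^'n"
  have "norm (2 *\<^sub>R (M *v ?x)) = norm ((M *v ?x - b) - (M *v (- ?x) - b))"
    by (simp add: linear_neg[OF matrix_vector_mul_linear] scaleR_2 del: scaleR_minus_right)
  also have "\<dots> \<le> 1 + 1"
    using norm_triangle_ineq4[of "M *v ?x - b" "M *v (- ?x) - b"] adm[of ?x] adm[of "- ?x"] \<open>0 < r\<close> by simp
  finally have "norm (M *v ?x) \<le> 1" by simp
  then have "\<bar>(M *v ?x) $ i\<bar> \<le> 1" using component_le_norm_cart order_trans by blast
  moreover have "(M *v ?x) $ i = r * M $ i $ j"
    by (simp add: matrix_vector_mult_scaleR matrix_vector_mult_basis column_def)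
  ultimately show "\<bar>M $ i $ j\<bar> \<le> 1 / r" using \<open>0 < r\<close> by (simp add: abs_mult field_simps)
qed

lemma compact_admissible:
  fixes K :: "(real^'n) set"
  assumes "0 \<in> interior K"
  shows "compact (admissible K)"
proof -
  obtain r where r: "0 < r" "cball 0 r \<subseteq> K" using assms by (auto simp: mem_interior_cball)
  have "norm z \<le> real CARD('n) * (real CARD('n) * (1 / r)) + 1" if "z \<in> admissible K" for z
  proof -
    obtain M b where z: "z = (M, b)" by fastforce
    have "norm (M $ i) \<le> (\<Sum>j\<in>UNIV. \<bar>M $ i $ j\<bar>)" for i by (rule norm_le_l1_cart)
    also have "\<dots> i \<le> (\<Sum>j\<in>(UNIV::'n set). 1 / r)" for i
      by (intro sum_mono admissible_bounded(2)[OF r that[unfolded z]])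
    finally have row: "norm (M $ i) \<le> real CARD('n) * (1 / r)" for i by simp
    have "norm M \<le> (\<Sum>i\<in>UNIV. norm (M $ i))" by (simp add: norm_vec_def L2_set_le_sum)
    also have "\<dots> \<le> (\<Sum>i\<in>(UNIV::'n set). real CARD('n) * (1 / r))" by (intro sum_mono row)
    finally have "norm M \<le> real CARD('n) * (real CARD('n) * (1 / r))" by simp
    moreover have "norm b \<le> 1" using admissible_bounded(1)[OF r] that z by blast
    moreover have "norm z \<le> norm M + norm b" unfolding z by (rule norm_Pair_le)
    ultimately show ?thesis by linarith
  qed
  then have "bounded (admissible K)" unfolding bounded_iff by blast
  moreover have "admissible K = (\<Inter>x\<in>K. {z. norm (fst z *v x - snd z) \<le> 1})"
    by (auto simp: admissible_def)
  then have "closed (admissible K)"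
    unfolding matrix_vector_mult_def
    by (auto intro!: closed_INT closed_Collect_le continuous_intros)
  ultimately show ?thesis by (simp add: compact_eq_bounded_closed)
qed

lemma lowner_exists:
  fixes K :: "(real^'n) set"
  assumes "compact K" "0 \<in> interior K"
  obtains M b where "(M, b) \<in> admissible K" "det M \<noteq> 0"
    "\<And>N d. (N, d) \<in> admissible K \<Longrightarrow> \<bar>det N\<bar> \<le> \<bar>det M\<bar>"
proof -
  obtain R where R: "0 < R" "\<And>x. x \<in> K \<Longrightarrow> norm x \<le> R"
    using compact_imp_bounded[OF \<open>compact K\<close>] by (auto simp: bounded_pos)
  \<comment> \<open>The ball of radius \<open>R\<close> contains \<open>K\<close>, so the maximal
    determinant is nonzero.\<close>
  have "(mat (1 / R), 0) \<in> admissible K"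
  proof -
    have "mat (1 / R) *v x - 0 = (1 / R) *\<^sub>R x" for x :: "real^'n"
      by (simp add: vec_eq_iff mat_def matrix_vector_mult_def if_distrib[of "\<lambda>z. z * _"] cong: if_cong)
    then show ?thesis using R by (simp add: admissible_def)
  qed
  moreover have "continuous_on (admissible K) (\<lambda>z. \<bar>det (fst z)\<bar>)"
    unfolding det_def by (intro continuous_intros)
  ultimately obtain z where z: "z \<in> admissible K" "\<And>y. y \<in> admissible K \<Longrightarrow> \<bar>det (fst y)\<bar> \<le> \<bar>det (fst z)\<bar>"
    using continuous_attains_sup[OF compact_admissible[OF assms(2)]] by blast
  have "0 < \<bar>det (mat (1 / R) :: real^'n^'n)\<bar>"
    using R by (simp add: det_diagonal mat_def)
  also have "\<dots> \<le> \<bar>det (fst z)\<bar>" using z(2)[OF \<open>(mat (1 / R), 0) \<in> admissible K\<close>] by simp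
  finally show ?thesis
    using that[of "fst z" "snd z"] z by fastforce
qed

lemma vol_affine_image:
  assumes "compact S" "invertible A"
  shows "vol ((\<lambda>x. c + A *v x) ` S) = \<bar>det A\<bar> * vol S"
  using measure_translation[of c "(*v) A ` S"] vol_matrix_image[OF assms] by (simp add: image_image)

lemma ellipsoid_atE:
  fixes E :: "(real^'n) set"
  assumes "ellipsoid_at c E"
  obtains M :: "real^'n^'n" where "invertible M" "E = {x. norm (M *v x - M *v c) \<le> 1}"
proof -
  obtain A :: "real^'n^'n" where A: "invertible A" "E = (\<lambda>x. c + A *v x) ` cball 0 1"
    using assms by (auto simp: ellipsoid_at_def)
  obtain M :: "real^'n^'n" where M: "A ** M = mat 1" "M ** A = mat 1" using A(1) by (auto simp: invertible_def)
  have "E = {x. norm (M *v x - M *v c) \<le> 1}"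
  proof (rule set_eqI)
    fix x
    have "x \<in> E \<longleftrightarrow> (\<exists>v. norm v \<le> 1 \<and> x = c + A *v v)" by (auto simp: A(2))
    also have "\<dots> \<longleftrightarrow> norm (M *v (x - c)) \<le> 1"
      by (auto simp: matrix_vector_mul_assoc M intro!: exI[of _ "M *v (x - c)"])
    finally show "x \<in> E \<longleftrightarrow> x \<in> {x. norm (M *v x - M *v c) \<le> 1}"
      by (simp add: matrix_vector_mult_diff_distrib)
  qed
  moreover have "invertible M" using M by (auto simp: invertible_def)
  ultimately show ?thesis using that by blast
qed

lemma ellipsoid_at_norm_le:
  fixes M :: "real^'n^'n"
  assumes "invertible M" "M *v c = b"
  shows "ellipsoid_at c {x. norm (M *v x - b) \<le> 1}"
    "vol {x. norm (M *v x - b) \<le> 1} = vol (cball 0 1 :: (real^'n) set) / \<bar>det M\<bar>"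
proof -
  obtain A :: "real^'n^'n" where A: "A ** M = mat 1" "M ** A = mat 1" using assms(1) by (auto simp: invertible_def)
  have inv: "invertible A" using A by (auto simp: invertible_def)
  have eq: "{x. norm (M *v x - b) \<le> 1} = (\<lambda>x. c + A *v x) ` cball 0 1"
  proof (rule set_eqI)
    fix x
    have "x \<in> (\<lambda>x. c + A *v x) ` cball 0 1 \<longleftrightarrow> (\<exists>v. norm v \<le> 1 \<and> x = c + A *v v)" by auto
    also have "\<dots> \<longleftrightarrow> norm (M *v (x - c)) \<le> 1"
      by (auto simp: matrix_vector_mul_assoc A intro!: exI[of _ "M *v (x - c)"])
    finally show "x \<in> {x. norm (M *v x - b) \<le> 1} \<longleftrightarrow> x \<in> (\<lambda>x. c + A *v x) ` cball 0 1"
      by (simp add: matrix_vector_mult_diff_distrib assms(2))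
  qed
  show "ellipsoid_at c {x. norm (M *v x - b) \<le> 1}"
    using eq inv by (auto simp: ellipsoid_at_def)
  have "det A * det M = 1" using A by (metis det_I det_mul)
  then have "\<bar>det A\<bar> = 1 / \<bar>det M\<bar>" by (metis abs_mult abs_one mult_zero_right nonzero_eq_divide_eq zero_neq_one abs_zero)
  then show "vol {x. norm (M *v x - b) \<le> 1} = vol (cball 0 1 :: (real^'n) set) / \<bar>det M\<bar>"
    unfolding eq by (simp add: vol_affine_image inv)
qed

text \<open>The containing ellipsoids correspond to the admissible pairs with invertible matrix, and
  volume is inversely proportional to the absolute determinant. A maximizing pair therefore attains
  the maximum that \<open>GREATEST\<close> denotes.\<close>

lemma evr_power:
  fixes K :: "(real^'n) set"
  assumes M: "(M, b) \<in> admissible K" "det M \<noteq> 0"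
    and max: "\<And>N d. (N, d) \<in> admissible K \<Longrightarrow> \<bar>det N\<bar> \<le> \<bar>det M\<bar>"
  shows "evr K ^ CARD('n) = vol K * \<bar>det M\<bar> / vol (cball 0 1 :: (real^'n) set)"
proof -
  let ?\<omega> = "vol (cball 0 1 :: (real^'n) set)"
  have inv: "invertible M" using M by (simp add: invertible_det_nz)
  then obtain c where c: "M *v c = b"
    by (metis invertible_def matrix_vector_mul_assoc matrix_vector_mul_lid)
  let ?E = "{x. norm (M *v x - b) \<le> 1}"
  have "evr K = root CARD('n) (vol K / vol ?E)"
    unfolding evr_def
  proof (rule Greatest_equality)
    show "\<exists>E. ellipsoid E \<and> K \<subseteq> E \<and> root CARD('n) (vol K / vol ?E) = root CARD('n) (vol K / vol E)"
      using ellipsoid_at_norm_le(1)[OF inv c] M(1)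
      by (intro exI[of _ ?E]) (auto simp: ellipsoid_def admissible_def)
    fix r assume "\<exists>E. ellipsoid E \<and> K \<subseteq> E \<and> r = root CARD('n) (vol K / vol E)"
    then obtain E e where E: "ellipsoid_at e E" "K \<subseteq> E" and r: "r = root CARD('n) (vol K / vol E)"
      by (auto simp: ellipsoid_def)
    obtain N :: "real^'n^'n" where N: "invertible N" and EN: "E = {x. norm (N *v x - N *v e) \<le> 1}" by (rule ellipsoid_atE[OF E(1)])
    have "\<bar>det N\<bar> \<le> \<bar>det M\<bar>"
      using E(2) by (intro max[of N "N *v e"]) (auto simp: admissible_def EN)
    then have "vol K / vol E \<le> vol K / vol ?E"
      unfolding EN ellipsoid_at_norm_le(2)[OF N refl] ellipsoid_at_norm_le(2)[OF inv c]
      by (auto intro!: divide_right_mono mult_left_mono)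
    then show "r \<le> root CARD('n) (vol K / vol ?E)" unfolding r by simp
  qed
  then show ?thesis
    by (simp add: real_root_pow_pos2 ellipsoid_at_norm_le(2)[OF inv c])
qed

section \<open>John's decomposition of the identity\<close>

lemma inner_outer: "H \<bullet> outer u = u \<bullet> (H *v u)"
  by (simp add: inner_vec_def outer_def matrix_vector_mult_def sum_distrib_left mult_ac)

lemma inner_mat_1: "H \<bullet> mat 1 = trace (H :: real^'n^'n)"
  by (simp add: inner_vec_def mat_def trace_def if_distrib[of "\<lambda>x. _ * x"] cong: if_cong)

text \<open>If \<open>(I / n, 0)\<close> were not a convex combination of the points \<open>(u\<otimes>u, u)\<close>, a separating functional
  would give a direction \<open>(H, h)\<close>, with \<open>trace H = 0\<close>, in which the constraints at the contact points
  become slack to first order while \<open>det\<close> is stationary.\<close>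

theorem john_decomposition:
  fixes K :: "(real^'n) set"
  assumes "compact K" and ball: "K \<subseteq> cball 0 1"
    and max: "\<And>M b. (M, b) \<in> admissible K \<Longrightarrow> \<bar>det M\<bar> \<le> 1"
  obtains S c where "finite S" "S \<subseteq> K" "\<And>u. u \<in> S \<Longrightarrow> norm u = 1" "\<And>u. u \<in> S \<Longrightarrow> 0 \<le> c u"
    "(\<Sum>u\<in>S. c u *\<^sub>R u) = 0" "\<And>x. (\<Sum>u\<in>S. (c u * (u \<bullet> x)) *\<^sub>R u) = x"
proof -
  define C where "C = K \<inter> sphere 0 1"
  define \<phi> where "\<phi> u = (outer u, u)" for u :: "real^'n"
  let ?n = "real CARD('n)"
  \<comment> \<open>Each \<open>outer u\<close> with \<open>u\<close> on the sphere has trace 1, so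
    convex weights can only produce the identity divided by n. The factor n is restored at the end
    in \<open>c\<close>.\<close>
  let ?p = "((1 / ?n) *\<^sub>R mat 1, 0) :: (real^'n^'n) \<times> (real^'n)"
  have "compact (\<phi> ` C)"
    unfolding \<phi>_def outer_def C_def
    by (intro compact_continuous_image continuous_intros compact_Int_closed \<open>compact K\<close>) auto
  then have X: "closed (convex hull (\<phi> ` C))" by (simp add: compact_convex_hull compact_imp_closed)
  have "?p \<in> convex hull (\<phi> ` C)"
  proof (rule ccontr)
    assume "?p \<notin> convex hull (\<phi> ` C)"
    then obtain a \<beta> where a: "a \<bullet> ?p < \<beta>" "\<And>z. z \<in> convex hull (\<phi> ` C) \<Longrightarrow> \<beta> < a \<bullet> z"
      using separating_hyperplane_closed_point[OF convex_convex_hull X] by blast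
    obtain H0 h0 where a_eq: "a = (H0, h0)" by fastforce
    \<comment> \<open>\<open>\<tau>\<close> is the value of the functional at \<open>?p\<close>.
      Subtracting this multiple of the identity makes \<open>H\<close> trace-free, and the change of
      sign turns separation into \<open>\<psi> u < - \<delta>\<close> at every contact
      point.\<close>
    define \<tau> where "\<tau> = trace H0 / ?n"
    define \<delta> where "\<delta> = \<beta> - \<tau>"
    define H where "H = \<tau> *\<^sub>R mat 1 - H0"
    define h where "h = - h0"
    define \<psi> where "\<psi> x = x \<bullet> (H *v x + h)" for x
    have "0 < \<delta>" using a(1) by (simp add: a_eq inner_Pair inner_mat_1 \<tau>_def \<delta>_def)
    have trH: "trace H = 0" by (simp add: H_def \<tau>_def trace_def mat_def sum_subtractf sum_distrib_left[symmetric])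
    have \<psi>C: "\<psi> u < - \<delta>" if "u \<in> C" for u
    proof -
      have "\<beta> < a \<bullet> \<phi> u" using that by (intro a(2) hull_inc) auto
      moreover have "u \<bullet> u = 1" using that by (simp add: C_def norm_eq_1)
      ultimately show ?thesis
        by (simp add: \<psi>_def H_def h_def a_eq \<phi>_def inner_Pair inner_outer \<delta>_def matrix_vector_mult_diff_rdistrib
            scaleR_matrix_vector_assoc[symmetric] inner_diff_right inner_add_right inner_commute)
    qed
    have cont: "continuous_on A \<psi>" for A unfolding \<psi>_def by (intro continuous_intros)
    \<comment> \<open>The part of \<open>K\<close> where no definite first-order decrease is
      available. It contains no contact point, so by compactness its points have norm uniformly
      below 1.\<close>
    define K1 where "K1 = K \<inter> {x. - \<delta> \<le> \<psi> x}"
    have "compact K1" unfolding K1_def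
      by (intro compact_Int_closed \<open>compact K\<close> closed_Collect_le cont continuous_intros)
    have "\<exists>\<eta>>0. \<forall>x\<in>K1. (norm x)\<^sup>2 \<le> 1 - \<eta>"
    proof (cases "K1 = {}")
      case True
      then show ?thesis by (intro exI[of _ 1]) auto
    next
      case False
      then obtain x0 where x0: "x0 \<in> K1" "\<And>x. x \<in> K1 \<Longrightarrow> (norm x)\<^sup>2 \<le> (norm x0)\<^sup>2"
        using continuous_attains_sup[OF \<open>compact K1\<close>, of "\<lambda>x. (norm x)\<^sup>2"] by (auto intro: continuous_intros)
      have "norm x0 \<noteq> 1" using x0(1) \<psi>C[of x0] by (auto simp: K1_def C_def)
      moreover have "norm x0 \<le> 1" using x0(1) ball by (auto simp: K1_def)
      ultimately have "(norm x0)\<^sup>2 < 1" by (simp add: power_less_one_iff abs_square_less_1)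
      then show ?thesis using x0(2) by (intro exI[of _ "1 - (norm x0)\<^sup>2"]) auto
    qed
    then obtain \<eta> where \<eta>: "0 < \<eta>" "\<And>x. x \<in> K1 \<Longrightarrow> (norm x)\<^sup>2 \<le> 1 - \<eta>" by blast
    have "compact ((\<lambda>x. (norm (H *v x + h))\<^sup>2) ` K)" "compact (\<psi> ` K)"
      by (intro compact_continuous_image \<open>compact K\<close> continuous_intros cont)+
    then obtain B1 B2 where "\<And>x. x \<in> K \<Longrightarrow> \<bar>(norm (H *v x + h))\<^sup>2\<bar> \<le> B1" "\<And>x. x \<in> K \<Longrightarrow> \<bar>\<psi> x\<bar> \<le> B2"
      by (fastforce dest!: compact_imp_bounded simp: bounded_iff)
    then obtain B where B: "\<And>x. x \<in> K \<Longrightarrow> (norm (H *v x + h))\<^sup>2 \<le> B" "\<And>x. x \<in> K \<Longrightarrow> \<psi> x \<le> B"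
      by (metis abs_le_D1 max.coboundedI1 max.coboundedI2)
    \<comment> \<open>The extra dilation makes the determinant grow at rate n times
      \<open>\<gamma>\<close>, since \<open>H\<close> is trace-free. It adds only
      \<open>2 * \<gamma>\<close>, half of the available decrease \<open>2 * \<delta>\<close>, to
      the rate of the squared norms.\<close>
    define \<gamma> where "\<gamma> = \<delta> / 2"
    define A where "A t = (1 + \<gamma> * t) *\<^sub>R (mat 1 + t *\<^sub>R H)" for t
    have "((\<lambda>t. det (A t)) has_real_derivative trace (\<gamma> *\<^sub>R mat 1 + H)) (at 0)"
    proof (rule has_real_derivative_det)
      show "((\<lambda>t. A t $ i $ j) has_real_derivative (\<gamma> *\<^sub>R mat 1 + H) $ i $ j) (at 0)" for i j
        unfolding A_def by (auto intro!: derivative_eq_intros)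
    qed (simp add: A_def)
    moreover have "trace (\<gamma> *\<^sub>R mat 1 + H) = ?n * \<gamma>"
      using trH by (simp add: trace_def mat_def sum.distrib)
    moreover have "0 < ?n * \<gamma>" using \<open>0 < \<delta>\<close> by (simp add: \<gamma>_def)
    ultimately obtain d1 where d1: "0 < d1" "\<And>t. 0 < t \<Longrightarrow> t < d1 \<Longrightarrow> det (A 0) < det (A t)"
      using DERIV_pos_inc_right[of "\<lambda>t. det (A t)" _ 0] by (metis add_0)
    \<comment> \<open>Bounds the squared norm outside \<open>K1\<close>: it starts at 1 with slope
      \<open>- \<delta>\<close>.\<close>
    define f1 where "f1 t = (1 + \<gamma> * t)\<^sup>2 * (1 - 2 * t * \<delta> + t\<^sup>2 * B)" for t
    have "(f1 has_real_derivative 2 * \<gamma> - 2 * \<delta>) (at 0)"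
      unfolding f1_def by (auto intro!: derivative_eq_intros)
    moreover have "2 * \<gamma> - 2 * \<delta> < 0" using \<open>0 < \<delta>\<close> by (simp add: \<gamma>_def)
    ultimately obtain d2 where d2: "0 < d2" "\<And>t. 0 < t \<Longrightarrow> t < d2 \<Longrightarrow> f1 t < f1 0"
      using DERIV_neg_dec_right[of f1 _ 0] by (metis add_0)
    \<comment> \<open>Bounds the squared norm on \<open>K1\<close>: it starts at
      \<open>1 - \<eta>\<close>, so continuity is enough.\<close>
    define f2 where "f2 t = (1 + \<gamma> * t)\<^sup>2 * (1 - \<eta> + 2 * t * B + t\<^sup>2 * B)" for t
    have "(f2 \<longlongrightarrow> f2 0) (at 0)" unfolding f2_def by (intro tendsto_intros)
    then have "\<forall>\<^sub>F t in at 0. f2 t < 1" by (rule order_tendstoD) (simp add: f2_def \<eta>)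
    then obtain d3 where d3: "0 < d3" "\<And>t. t \<noteq> 0 \<Longrightarrow> \<bar>t\<bar> < d3 \<Longrightarrow> f2 t < 1"
      by (auto simp: eventually_at dist_real_def)
    define t where "t = min d1 (min d2 d3) / 2"
    have t: "0 < t" "t < d1" "t < d2" "\<bar>t\<bar> < d3" using d1 d2 d3 by (auto simp: t_def)
    have "(A t, - ((1 + \<gamma> * t) * t) *\<^sub>R h) \<in> admissible K"
      unfolding admissible_def
    proof (clarify)
      fix x assume x: "x \<in> K"
      have "A t *v x - (- ((1 + \<gamma> * t) * t)) *\<^sub>R h = (1 + \<gamma> * t) *\<^sub>R (x + t *\<^sub>R (H *v x + h))"
        by (simp add: A_def scaleR_matrix_vector_assoc[symmetric] matrix_vector_mult_add_rdistrib algebra_simps)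
      then have "(norm (A t *v x - (- ((1 + \<gamma> * t) * t)) *\<^sub>R h))\<^sup>2 = (1 + \<gamma> * t)\<^sup>2 * (norm (x + t *\<^sub>R (H *v x + h)))\<^sup>2"
        by (simp add: power_mult_distrib)
      also have "(norm (x + t *\<^sub>R (H *v x + h)))\<^sup>2 = (norm x)\<^sup>2 + 2 * t * \<psi> x + t\<^sup>2 * (norm (H *v x + h))\<^sup>2"
      proof -
        have "(norm (x + t *\<^sub>R v))\<^sup>2 = (norm x)\<^sup>2 + 2 * t * (x \<bullet> v) + t\<^sup>2 * (norm v)\<^sup>2" for v
          unfolding power2_norm_eq_inner
          by (simp add: inner_add_left inner_add_right inner_commute power2_eq_square algebra_simps)
        then show ?thesis by (simp only: \<psi>_def)
      qed
      also have "(1 + \<gamma> * t)\<^sup>2 * \<dots> \<le> 1"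
      proof (cases "x \<in> K1")
        case True
        have "(1 + \<gamma> * t)\<^sup>2 * ((norm x)\<^sup>2 + 2 * t * \<psi> x + t\<^sup>2 * (norm (H *v x + h))\<^sup>2) \<le> f2 t"
          unfolding f2_def by (intro mult_left_mono add_mono \<eta> B x True) (use t in auto)
        also have "\<dots> < 1" using d3 t by auto
        finally show ?thesis by simp
      next
        case False
        then have "\<psi> x \<le> - \<delta>" using x by (auto simp: K1_def)
        from mult_left_mono[OF this, of "2 * t"] have "2 * t * \<psi> x \<le> - (2 * t * \<delta>)" using t by simp
        moreover have "(norm x)\<^sup>2 \<le> 1" using ball x by (auto simp: power_le_one)
        moreover have "t\<^sup>2 * (norm (H *v x + h))\<^sup>2 \<le> t\<^sup>2 * B" by (intro mult_left_mono B x) auto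
        ultimately have "(norm x)\<^sup>2 + 2 * t * \<psi> x + t\<^sup>2 * (norm (H *v x + h))\<^sup>2 \<le> 1 - 2 * t * \<delta> + t\<^sup>2 * B"
          by linarith
        then have "(1 + \<gamma> * t)\<^sup>2 * ((norm x)\<^sup>2 + 2 * t * \<psi> x + t\<^sup>2 * (norm (H *v x + h))\<^sup>2) \<le> f1 t"
          unfolding f1_def by (rule mult_left_mono) simp
        also have "\<dots> < 1" using d2(2)[of t] t by (simp add: f1_def)
        finally show ?thesis by simp
      qed
      finally show "norm (A t *v x - (- ((1 + \<gamma> * t) * t)) *\<^sub>R h) \<le> 1"
        by (simp add: abs_square_le_1)
    qed
    then have "\<bar>det (A t)\<bar> \<le> 1" by (rule max)
    moreover have "1 < det (A t)" using d1(2)[of t] t by (simp add: A_def)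
    ultimately show False by simp
  qed
  then obtain T w where T: "finite T" "T \<subseteq> \<phi> ` C" "\<And>z. z \<in> T \<Longrightarrow> 0 \<le> w z" "(\<Sum>z\<in>T. w z *\<^sub>R z) = ?p"
    by (auto simp: convex_hull_explicit)
  define S where "S = snd ` T"
  define c where "c u = ?n * w (\<phi> u)" for u
  have T_eq: "T = \<phi> ` S"
    using T(2) by (force simp: S_def \<phi>_def image_image)
  have inj: "inj_on \<phi> S" by (auto simp: inj_on_def \<phi>_def)
  have SC: "S \<subseteq> C" using T(2) by (force simp: S_def \<phi>_def)
  have *: "(\<Sum>u\<in>S. w (\<phi> u) *\<^sub>R \<phi> u) = ?p"
    using T(4) by (simp add: T_eq sum.reindex[OF inj])
  have "(\<Sum>u\<in>S. w (\<phi> u) *\<^sub>R u) = 0"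
    using arg_cong[OF *, of snd] by (simp add: snd_sum \<phi>_def)
  then have "?n *\<^sub>R (\<Sum>u\<in>S. w (\<phi> u) *\<^sub>R u) = 0" by simp
  then have c0: "(\<Sum>u\<in>S. c u *\<^sub>R u) = 0" by (simp add: c_def scaleR_sum_right)
  have o: "(\<Sum>u\<in>S. w (\<phi> u) *\<^sub>R outer u) = (1 / ?n) *\<^sub>R mat 1"
    using arg_cong[OF *, of fst] by (simp add: fst_sum \<phi>_def)
  have "?n *\<^sub>R (\<Sum>u\<in>S. w (\<phi> u) *\<^sub>R outer u) = mat 1" unfolding o by simp
  then have c1: "(\<Sum>u\<in>S. c u *\<^sub>R outer u) = mat 1" by (simp add: c_def scaleR_sum_right)
  have "(\<Sum>u\<in>S. (c u * (u \<bullet> x)) *\<^sub>R u) = (\<Sum>u\<in>S. c u *\<^sub>R outer u) *v x" for x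
    by (induction S rule: infinite_finite_induct)
      (simp_all add: matrix_vector_mult_add_rdistrib scaleR_matrix_vector_assoc[symmetric] outer_mult_vec)
  then have c2: "(\<Sum>u\<in>S. (c u * (u \<bullet> x)) *\<^sub>R u) = x" for x by (simp add: c1)
  show ?thesis
  proof (rule that[of S c])
    show "0 \<le> c u" if "u \<in> S" for u using that T(3) by (auto simp: c_def T_eq)
  qed (use SC T c0 c2 in \<open>auto simp: C_def S_def\<close>)
qed

section \<open>Volumes of bodies in John position\<close>

lemma nn_integral_power_exp:
  assumes "0 < a"
  shows "(\<integral>\<^sup>+ t. ennreal (t ^ k * exp (- (a * t))) * indicator {0<..} t \<partial>lborel) = ennreal (fact k / a ^ Suc k)"
proof -
  have "ennreal (fact k) = (\<integral>\<^sup>+ t. ennreal (t ^ k * exp (- t)) * indicator {0..} t \<partial>lborel)"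
    using nn_intergal_power_times_exp_Ici[of k] by simp
  also have "\<dots> = ennreal \<bar>a\<bar> * (\<integral>\<^sup>+ t. ennreal ((0 + a * t) ^ k * exp (- (0 + a * t))) * indicator {0..} (0 + a * t) \<partial>lborel)"
    using assms by (intro nn_integral_real_affine) auto
  also have "\<dots> = ennreal a * (\<integral>\<^sup>+ t. ennreal (a ^ k) * (ennreal (t ^ k * exp (- (a * t))) * indicator {0<..} t) \<partial>lborel)"
  proof (rule arg_cong2[where f = "(*)"], goal_cases)
    case 2
    have "ennreal ((0 + a * t) ^ k * exp (- (0 + a * t))) * indicator {0..} (0 + a * t)
      = ennreal (a ^ k) * (ennreal (t ^ k * exp (- (a * t))) * indicator {0<..} t)" if "t \<noteq> 0" for t
      using assms that
      by (auto simp: power_mult_distrib ennreal_mult'[symmetric] mult.assoc zero_le_mult_iff split: split_indicator)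
    then show ?case
      by (intro nn_integral_cong_AE eventually_mono[OF AE_lborel_singleton[of 0]])
  qed (use assms in simp)
  also have "\<dots> = ennreal (a ^ Suc k) * (\<integral>\<^sup>+ t. ennreal (t ^ k * exp (- (a * t))) * indicator {0<..} t \<partial>lborel)"
    using assms by (subst nn_integral_cmult) (auto simp: ennreal_mult mult.assoc)
  finally have *: "ennreal (fact k) = ennreal (a ^ Suc k) * (\<integral>\<^sup>+ t. ennreal (t ^ k * exp (- (a * t))) * indicator {0<..} t \<partial>lborel)" .
  have "ennreal (fact k / a ^ Suc k) = ennreal (1 / a ^ Suc k) * ennreal (fact k)"
    using assms by (subst ennreal_mult[symmetric]) auto
  also have "\<dots> = (ennreal (1 / a ^ Suc k) * ennreal (a ^ Suc k)) * (\<integral>\<^sup>+ t. ennreal (t ^ k * exp (- (a * t))) * indicator {0<..} t \<partial>lborel)"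
    unfolding * by (simp only: mult.assoc)
  also have "ennreal (1 / a ^ Suc k) * ennreal (a ^ Suc k) = 1"
    using assms by (subst ennreal_mult[symmetric]) auto
  finally show ?thesis by simp
qed

lemma emeasure_scaled_compact:
  fixes K :: "'a::euclidean_space set"
  assumes "compact K" "0 < s"
  shows "emeasure lborel {x. x /\<^sub>R s \<in> K} = ennreal (s ^ DIM('a) * measure lebesgue K)"
proof -
  have eq: "{x. x /\<^sub>R s \<in> K} = (\<lambda>x. s *\<^sub>R x + 0) ` K"
  proof safe
    fix x assume "x /\<^sub>R s \<in> K"
    then show "x \<in> (\<lambda>x. s *\<^sub>R x + 0) ` K" using assms(2) by (intro image_eqI[of _ _ "x /\<^sub>R s"]) auto
  qed (use assms(2) in auto)
  have "compact {x. x /\<^sub>R s \<in> K}"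
    unfolding eq by (intro compact_continuous_image assms continuous_intros)
  then have "emeasure lborel {x. x /\<^sub>R s \<in> K} = emeasure lebesgue {x. x /\<^sub>R s \<in> K}"
    by (simp add: compact_imp_closed)
  also have "\<dots> = ennreal (s ^ DIM('a)) * emeasure lebesgue K"
    unfolding eq using assms(2) by (subst emeasure_lebesgue_affine) (simp add: ennreal_power)
  also have "\<dots> = ennreal (s ^ DIM('a) * measure lebesgue K)"
    using assms by (simp add: emeasure_eq_measure2 lmeasurable_compact ennreal_mult)
  finally show ?thesis .
qed

text \<open>The slice of the cone at height \<open>t\<close> is a dilate of \<open>K\<close>, with
  volume proportional to the n-th power of \<open>t\<close>; the remaining integral is a Gamma
  integral. The case a = b = 1 serves the gauge, other values the lifted simplex argument.\<close>

lemma nn_integral_cone: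
  fixes K :: "'a::euclidean_space set"
  assumes "compact K" "0 < a" "0 < b"
  shows "(\<integral>\<^sup>+ t. (\<integral>\<^sup>+ x. ennreal (exp (- (a * t))) * indicator {0<..} t * indicator K (x /\<^sub>R (b * t)) \<partial>lborel) \<partial>lborel)
    = ennreal (b ^ DIM('a) * measure lebesgue K * fact DIM('a) / a ^ Suc DIM('a))"
proof -
  have "(\<integral>\<^sup>+ x. ennreal (exp (- (a * t))) * indicator {0<..} t * indicator K (x /\<^sub>R (b * t)) \<partial>lborel)
      = ennreal (b ^ DIM('a) * measure lebesgue K) * (ennreal (t ^ DIM('a) * exp (- (a * t))) * indicator {0<..} t)" for t
  proof (cases "0 < t")
    case True
    have K: "K \<in> sets borel" using assms by (simp add: compact_imp_closed borel_closed)
    have "(\<integral>\<^sup>+ x. ennreal (exp (- (a * t))) * indicator {0<..} t * indicator K (x /\<^sub>R (b * t)) \<partial>lborel)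
        = ennreal (exp (- (a * t))) * (\<integral>\<^sup>+ x. indicator {x. x /\<^sub>R (b * t) \<in> K} x \<partial>lborel)"
      using True K by (subst nn_integral_cmult[symmetric]) (auto intro!: nn_integral_cong split: split_indicator)
    also have "(\<integral>\<^sup>+ x. indicator {x. x /\<^sub>R (b * t) \<in> K} x \<partial>lborel) = ennreal ((b * t) ^ DIM('a) * measure lebesgue K)"
      using True K emeasure_scaled_compact[OF assms(1), of "b * t"] assms(3) by (subst nn_integral_indicator) auto
    finally show ?thesis
      using True assms by (simp add: ennreal_mult[symmetric] power_mult_distrib mult_ac)
  qed simp
  then have "(\<integral>\<^sup>+ t. (\<integral>\<^sup>+ x. ennreal (exp (- (a * t))) * indicator {0<..} t * indicator K (x /\<^sub>R (b * t)) \<partial>lborel) \<partial>lborel)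
     = ennreal (b ^ DIM('a) * measure lebesgue K) * ennreal (fact DIM('a) / a ^ Suc DIM('a))"
    using assms by (simp add: nn_integral_cmult nn_integral_power_exp)
  then show ?thesis using assms by (simp add: ennreal_mult[symmetric])
qed

text \<open>For convex \<open>K\<close> with \<open>0 \<in> K\<close> this is \<open>exp (- \<parallel>x\<parallel>\<^sub>K)\<close>, written without reference to the gauge
  \<open>\<parallel>x\<parallel>\<^sub>K\<close>; the point \<open>t = 0\<close>, where \<open>x /\<^sub>R t = 0\<close>, is excluded.\<close>

definition expgauge :: "'a::euclidean_space set \<Rightarrow> 'a \<Rightarrow> ennreal"
  where "expgauge K x = (\<integral>\<^sup>+ t. ennreal (exp (- t)) * indicator {0<..} t * indicator K (x /\<^sub>R t) \<partial>lborel)"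

lemma borel_measurable_cone [measurable]:
  fixes K :: "'a::euclidean_space set"
  assumes [measurable]: "K \<in> sets borel"
  shows "(\<lambda>(x, t). ennreal (exp (- (a * t))) * indicator {0<..} t * indicator K (x /\<^sub>R (b * t)))
    \<in> borel_measurable (lborel \<Otimes>\<^sub>M lborel)"
  by measurable

lemma borel_measurable_expgauge:
  assumes "compact K"
  shows "expgauge K \<in> borel_measurable borel"
proof -
  have K: "K \<in> sets borel" using assms by (simp add: compact_imp_closed borel_closed)
  have "(\<lambda>x. \<integral>\<^sup>+ t. ennreal (exp (- t)) * indicator {0<..} t * indicator K (x /\<^sub>R t) \<partial>lborel) \<in> borel_measurable lborel"
    using lborel.borel_measurable_nn_integral[OF borel_measurable_cone[OF K, of 1 1]] by simp
  then show ?thesis by (simp add: expgauge_def[abs_def])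
qed

text \<open>By Fubini the point is integrated first, which produces the volumes of the dilates of
  \<open>K\<close>.\<close>

lemma nn_integral_expgauge:
  fixes K :: "'a::euclidean_space set"
  assumes "compact K"
  shows "(\<integral>\<^sup>+ x. expgauge K x \<partial>lborel) = ennreal (fact DIM('a) * measure lebesgue K)"
proof -
  have K: "K \<in> sets borel" using assms by (simp add: compact_imp_closed borel_closed)
  have "(\<integral>\<^sup>+ x. expgauge K x \<partial>lborel)
    = (\<integral>\<^sup>+ t. (\<integral>\<^sup>+ x. ennreal (exp (- (1 * t))) * indicator {0<..} t * indicator K (x /\<^sub>R (1 * t)) \<partial>lborel) \<partial>lborel)"
    unfolding expgauge_def using lborel_pair.Fubini'[OF borel_measurable_cone[OF K, of 1 1]] by simp
  then show ?thesis using assms by (simp only: nn_integral_cone zero_less_one) (simp add: mult_ac)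
qed

lemma nn_integral_exp_greaterThan: "(\<integral>\<^sup>+ t. ennreal (exp (- t)) * indicator {s<..} t \<partial>lborel) = ennreal (exp (- s))"
proof -
  have "(\<integral>\<^sup>+ t. ennreal (exp (- t)) * indicator {s<..} t \<partial>lborel) = (\<integral>\<^sup>+ t. ennreal (exp (- t)) * indicator {s..} t \<partial>lborel)"
    by (intro nn_integral_cong_AE eventually_mono[OF AE_lborel_singleton[of s]]) (auto split: split_indicator)
  also have "\<dots> = ennreal (0 - (- exp (- s)))"
  proof (rule nn_integral_FTC_atLeast)
    show "((\<lambda>t::real. - exp (- t)) \<longlongrightarrow> 0) at_top"
      using tendsto_minus[OF filterlim_compose[OF exp_at_bot filterlim_uminus_at_bot_at_top]] by simp
  qed (auto intro!: derivative_eq_intros)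
  finally show ?thesis by simp
qed

lemma expgauge_le_1: "expgauge K x \<le> 1"
proof -
  have "expgauge K x \<le> (\<integral>\<^sup>+ t. ennreal (exp (- t)) * indicator {0<..} t \<partial>lborel)"
    unfolding expgauge_def by (intro nn_integral_mono) (auto split: split_indicator)
  then show ?thesis by (simp add: nn_integral_exp_greaterThan)
qed

text \<open>The gauge at \<open>s *\<^sub>R k\<close> is at most \<open>s\<close>: \<open>K\<close>
  is star-shaped about 0, so the point lies in every dilate by \<open>t > s\<close>.\<close>

lemma expgauge_ge:
  assumes "convex K" "0 \<in> K" "0 \<le> s" "k \<in> K"
  shows "ennreal (exp (- s)) \<le> expgauge K (s *\<^sub>R k)"
proof -
  have "(s *\<^sub>R k) /\<^sub>R t \<in> K" if "s < t" for t
  proof -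
    have "(s / t) *\<^sub>R k + (1 - s / t) *\<^sub>R 0 \<in> K"
      using assms that by (intro convexD) auto
    then show ?thesis by (simp add: divide_inverse mult.commute)
  qed
  then have "(\<integral>\<^sup>+ t. ennreal (exp (- t)) * indicator {s<..} t \<partial>lborel) \<le> expgauge K (s *\<^sub>R k)"
    unfolding expgauge_def
    using assms by (intro nn_integral_mono) (auto split: split_indicator)
  then show ?thesis by (simp only: nn_integral_exp_greaterThan)
qed

lemma integrable_nn_integral_ennreal:
  assumes "f \<in> borel_measurable M" "\<And>x. 0 \<le> f x" "(\<integral>\<^sup>+ x. ennreal (f x) \<partial>M) = ennreal v" "0 \<le> v"
  shows "integrable M f" "integral\<^sup>L M f = v"
  using assms by (auto intro!: integrableI_nonneg simp: integral_eq_nn_integral)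

lemma integral_expgauge:
  fixes K :: "'a::euclidean_space set"
  assumes "compact K"
  shows "integrable lborel (\<lambda>x. enn2real (expgauge K x))"
    "integral\<^sup>L lborel (\<lambda>x. enn2real (expgauge K x)) = fact DIM('a) * measure lebesgue K"
proof -
  have "expgauge K x < top" for x :: 'a
    using expgauge_le_1[of K x] by (simp add: order_le_less_trans)
  then have "ennreal (enn2real (expgauge K x)) = expgauge K x" for x :: 'a by (simp add: less_top)
  then have "(\<integral>\<^sup>+ x. ennreal (enn2real (expgauge K x)) \<partial>lborel) = ennreal (fact DIM('a) * measure lebesgue K)"
    using nn_integral_expgauge[OF assms] by simp
  moreover have "(\<lambda>x. enn2real (expgauge K x)) \<in> borel_measurable lborel"
    using borel_measurable_expgauge[OF assms] by simp
  ultimately show "integrable lborel (\<lambda>x. enn2real (expgauge K x))"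
    "integral\<^sup>L lborel (\<lambda>x. enn2real (expgauge K x)) = fact DIM('a) * measure lebesgue K"
    by (auto intro!: integrable_nn_integral_ennreal)
qed

text \<open>By symmetry \<open>K\<close> contains every \<open>u\<close> and \<open>- u\<close>. A
  combination with coefficients \<open>c u * \<theta> u\<close> is therefore \<open>s\<close> times
  a point of \<open>K\<close>, where \<open>s\<close> is the weighted sum of the absolute values,
  and exp of minus the gauge dominates the product of Laplace factors.\<close>

theorem vol_ge_cross_polytope:
  fixes K :: "(real^'n) set"
  assumes "compact K" "convex K" "0 \<in> K" and sym: "uminus ` K = K"
    and S: "finite S" "S \<subseteq> K" "\<And>u. u \<in> S \<Longrightarrow> norm u = 1" "\<And>u. u \<in> S \<Longrightarrow> 0 \<le> c u"
    and iso: "\<And>x. (\<Sum>u\<in>S. (c u * (u \<bullet> x)) *\<^sub>R u) = x"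
  shows "2 ^ CARD('n) / fact CARD('n) \<le> vol K"
proof -
  obtain T T' :: "real \<Rightarrow> real" where T: "\<And>t. (T has_real_derivative T' t) (at t)" "\<And>t. 0 < T' t"
    "\<And>t. exp (- \<bar>T t\<bar>) * T' t = 2 * std_normal_density t" using laplace_transport by blast
  have "2 ^ CARD('n) \<le> integral\<^sup>L lborel (\<lambda>x. enn2real (expgauge K x))"
  proof (rule barthe_inequality[OF S(1,3,4) iso T])
    fix y :: "real^'n"
    define \<theta> where "\<theta> u = T (u \<bullet> y)" for u :: "real^'n"
    define s where "s = (\<Sum>u\<in>S. c u * \<bar>\<theta> u\<bar>)"
    define x where "x = (\<Sum>u\<in>S. (c u * \<theta> u) *\<^sub>R u)"
    have "0 \<le> s" unfolding s_def by (intro sum_nonneg mult_nonneg_nonneg S) auto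
    have "\<exists>k\<in>K. x = s *\<^sub>R k"
    proof (cases "s = 0")
      case True
      then have "\<forall>u\<in>S. c u * \<bar>\<theta> u\<bar> = 0"
        unfolding s_def by (subst (asm) sum_nonneg_eq_0_iff) (auto intro!: mult_nonneg_nonneg S)
      then have "x = 0" by (auto simp: x_def intro!: sum.neutral)
      then show ?thesis using True \<open>0 \<in> K\<close> by auto
    next
      case False
      with \<open>0 \<le> s\<close> have "0 < s" by simp
      have "(\<Sum>u\<in>S. (c u * \<bar>\<theta> u\<bar> / s) *\<^sub>R (if 0 \<le> \<theta> u then u else - u)) \<in> K"
      proof (rule convex_sum)
        show "(if 0 \<le> \<theta> u then u else - u) \<in> K" if "u \<in> S" for u
          using that S(2) sym by force
        show "(\<Sum>u\<in>S. c u * \<bar>\<theta> u\<bar> / s) = 1"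
          using \<open>0 < s\<close> by (simp add: sum_divide_distrib[symmetric] s_def[symmetric])
        show "0 \<le> c u * \<bar>\<theta> u\<bar> / s" if "u \<in> S" for u
          using that S(4) \<open>0 < s\<close> by auto
      qed (use S \<open>convex K\<close> in auto)
      moreover have "x = s *\<^sub>R (\<Sum>u\<in>S. (c u * \<bar>\<theta> u\<bar> / s) *\<^sub>R (if 0 \<le> \<theta> u then u else - u))"
        unfolding x_def scaleR_sum_right using \<open>0 < s\<close> by (intro sum.cong) auto
      ultimately show ?thesis by blast
    qed
    then obtain k where "k \<in> K" "x = s *\<^sub>R k" by blast
    then have "ennreal (exp (- s)) \<le> expgauge K x"
      using expgauge_ge[OF assms(2,3) \<open>0 \<le> s\<close>] by simp
    then have "enn2real (ennreal (exp (- s))) \<le> enn2real (expgauge K x)"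
      using expgauge_le_1[of K x] by (intro enn2real_mono) (auto simp: order_le_less_trans)
    then show "exp (- (\<Sum>u\<in>S. c u * \<bar>T (u \<bullet> y)\<bar>)) \<le> enn2real (expgauge K (\<Sum>u\<in>S. (c u * T (u \<bullet> y)) *\<^sub>R u))"
      by (simp add: s_def x_def \<theta>_def)
  qed (use integral_expgauge[OF \<open>compact K\<close>] in auto)
  then show ?thesis by (simp add: integral_expgauge[OF \<open>compact K\<close>] field_simps)
qed

section \<open>Appending a coordinate, and the simplex bound\<close>

lemma sum_option: "(\<Sum>k\<in>UNIV. f k) = f None + (\<Sum>i\<in>UNIV. f (Some (i::'n::finite)))"
  by (simp add: UNIV_option_conv sum.reindex)

lemma prod_option: "(\<Prod>k\<in>UNIV. f k) = f None * (\<Prod>i\<in>UNIV. f (Some (i::'n::finite)))"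
  by (simp add: UNIV_option_conv prod.reindex)

definition vec_append :: "real^'n \<Rightarrow> real \<Rightarrow> real^'n option"
  where "vec_append x r = (\<chi> k. case k of None \<Rightarrow> r | Some i \<Rightarrow> x $ i)"

definition front :: "real^'n option \<Rightarrow> real^'n"
  where "front z = (\<chi> i. z $ Some i)"

lemma vec_append_nth [simp]: "vec_append x r $ None = r" "vec_append x r $ Some i = x $ i"
  by (simp_all add: vec_append_def)

lemma front_vec_append [simp]: "front (vec_append x r) = x"
  by (simp add: front_def vec_eq_iff)

lemma inner_vec_append: "vec_append x r \<bullet> z = x \<bullet> front z + r * z $ None"
  by (simp add: inner_vec_def sum_option front_def)

lemma vec_append_eq_iff: "vec_append x r = z \<longleftrightarrow> x = front z \<and> r = z $ None"
  by (auto simp: vec_eq_iff front_def vec_append_def split: option.split)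

lemma borel_measurable_vec_append [measurable]:
  "(\<lambda>(x, r). vec_append (x :: real^'n) r) \<in> borel_measurable (lborel \<Otimes>\<^sub>M lborel)"
proof -
  have "linear (\<lambda>(x, r). vec_append (x :: real^'n) r)"
    by (rule linearI) (auto simp: vec_eq_iff vec_append_def split: option.split)
  then have "(\<lambda>(x, r). vec_append (x :: real^'n) r) \<in> borel_measurable borel"
    by (intro borel_measurable_continuous_onI linear_continuous_on) (simp add: linear_conv_bounded_linear[symmetric])
  then show ?thesis by (simp add: lborel_prod)
qed

lemma distr_vec_append:
  "distr (lborel \<Otimes>\<^sub>M lborel) borel (\<lambda>(x, r). vec_append (x :: real^'n) r) = lborel"
proof (rule lborel_eqI[symmetric])
  fix l u :: "real^'n option" assume lu: "\<And>b. b \<in> Basis \<Longrightarrow> l \<bullet> b \<le> u \<bullet> b"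
  have lu': "l $ k \<le> u $ k" for k
    using lu[of "axis k 1"] by (simp add: axis_in_Basis_iff inner_axis)
  have pre: "(\<lambda>(x, r). vec_append (x :: real^'n) r) -` box l u \<inter> space (lborel \<Otimes>\<^sub>M lborel)
      = box (front l) (front u) \<times> box (l $ None) (u $ None)"
    by (auto simp: mem_box_cart front_def vec_append_def space_pair_measure split: option.splits)
  have "emeasure (distr (lborel \<Otimes>\<^sub>M lborel) borel (\<lambda>(x, r). vec_append (x :: real^'n) r)) (box l u)
      = emeasure lborel (box (front l) (front u)) * emeasure lborel (box (l $ None) (u $ None))"
    by (subst emeasure_distr) (auto simp: pre lborel.emeasure_pair_measure_Times)
  also have "emeasure lborel (box (front l) (front u)) = ennreal (\<Prod>i\<in>UNIV. u $ Some i - l $ Some i)"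
  proof (subst emeasure_lborel_box)
    show "front l \<bullet> b \<le> front u \<bullet> b" if "b \<in> Basis" for b
      using that lu' by (auto simp: Basis_vec_def inner_axis front_def)
  qed (simp add: inner_axis front_def prod_Basis_cart)
  also have "emeasure lborel (box (l $ None) (u $ None)) = ennreal (u $ None - l $ None)"
    using lu' by (subst emeasure_lborel_box) auto
  finally show "emeasure (distr (lborel \<Otimes>\<^sub>M lborel) borel (\<lambda>(x, r). vec_append (x :: real^'n) r)) (box l u)
      = ennreal (prod ((\<bullet>) (u - l)) Basis)"
    using lu' by (simp add: prod_Basis_cart prod_option inner_axis ennreal_mult[symmetric] prod_nonneg mult.commute)
qed simp

text \<open>The contact points are lifted to unit vectors with a common positive last coordinate.
  Positive combinations of them stay in a cone over \<open>K\<close>, so a density on the positive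
  half-line suits the lift as the symmetric Laplace density suits a symmetric body.\<close>

theorem vol_ge_simplex:
  fixes K :: "(real^'n) set"
  assumes "compact K" "convex K"
    and S: "finite S" "S \<subseteq> K" "\<And>u. u \<in> S \<Longrightarrow> norm u = 1" "\<And>u. u \<in> S \<Longrightarrow> 0 \<le> c u"
    and cent: "(\<Sum>u\<in>S. c u *\<^sub>R u) = 0"
    and iso: "\<And>x. (\<Sum>u\<in>S. (c u * (u \<bullet> x)) *\<^sub>R u) = x"
  shows "sqrt (real CARD('n) + 1) ^ Suc CARD('n) / (fact CARD('n) * sqrt (real CARD('n)) ^ CARD('n)) \<le> vol K"
proof -
  let ?n = "real CARD('n)"
  define a where "a = sqrt (?n + 1)"
  define b where "b = sqrt ?n"
  have ab: "0 < a" "0 < b" "a\<^sup>2 = ?n + 1" "b\<^sup>2 = ?n" by (auto simp: a_def b_def)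
  define v where "v u = vec_append ((b / a) *\<^sub>R u) (1 / a)" for u :: "real^'n"
  \<comment> \<open>The argument of \<open>c\<close> recovers \<open>u\<close> from its lift. The
    factor (n + 1) / n raises the total weight from n to n + 1, as the trace requires in the larger
    dimension.\<close>
  define d where "d z = (a\<^sup>2 / b\<^sup>2) * c ((a / b) *\<^sub>R front z)" for z :: "real^'n option"
  \<comment> \<open>An exponential on the cone over \<open>K\<close>. The slope \<open>b\<close>
    makes the lift of a point of \<open>K\<close> lie in the cone, and the rate \<open>a\<close>
    cancels the height \<open>1 / a\<close> of the lifted vectors.\<close>
  define F where "F z = exp (- (a * z $ None)) * indicator {0<..} (z $ None) * indicator K (front z /\<^sub>R (b * z $ None))"
    for z :: "real^'n option"
  have dv: "d (v u) = (a\<^sup>2 / b\<^sup>2) * c u" for u using ab by (simp add: d_def v_def)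
  have v_nth: "v u $ None = 1 / a" "v u $ Some i = b / a * u $ i" for u i by (simp_all add: v_def)
  have inj: "inj_on v S" using ab by (auto simp: inj_on_def v_def vec_append_eq_iff)
  have sumc: "(\<Sum>u\<in>S. c u) = ?n" by (rule sum_isotropic_weights[OF S(3) iso])
  have K: "K \<in> sets borel" using assms by (simp add: compact_imp_closed borel_closed)
  have [measurable]: "(front :: real^'n option \<Rightarrow> real^'n) \<in> borel_measurable borel"
  proof (intro borel_measurable_continuous_onI linear_continuous_on)
    have "linear (front :: real^'n option \<Rightarrow> real^'n)"
      by (rule linearI) (auto simp: front_def vec_eq_iff)
    then show "bounded_linear (front :: real^'n option \<Rightarrow> real^'n)"
      by (simp add: linear_conv_bounded_linear)
  qed
  have [measurable]: "F \<in> borel_measurable borel" unfolding F_def using K by measurable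
  have "(\<integral>\<^sup>+ z. ennreal (F z) \<partial>lborel) = (\<integral>\<^sup>+ p. ennreal (F (case p of (x, r) \<Rightarrow> vec_append x r)) \<partial>(lborel \<Otimes>\<^sub>M lborel))"
    by (subst distr_vec_append[symmetric], subst nn_integral_distr) auto
  also have "\<dots> = (\<integral>\<^sup>+ p. (case p of (x, t) \<Rightarrow> ennreal (exp (- (a * t))) * indicator {0<..} t * indicator K (x /\<^sub>R (b * t)))
      \<partial>(lborel \<Otimes>\<^sub>M lborel))"
    by (intro nn_integral_cong) (auto simp: F_def split: split_indicator)
  also have "\<dots> = (\<integral>\<^sup>+ t. (\<integral>\<^sup>+ x. ennreal (exp (- (a * t))) * indicator {0<..} t * indicator K (x /\<^sub>R (b * t)) \<partial>lborel) \<partial>lborel)"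
    using lborel_pair.nn_integral_snd[OF borel_measurable_cone[OF K], symmetric] by simp
  also have "\<dots> = ennreal (b ^ CARD('n) * vol K * fact CARD('n) / a ^ Suc CARD('n))"
    using nn_integral_cone[OF assms(1) ab(1,2)] by simp
  finally have nnF: "(\<integral>\<^sup>+ z. ennreal (F z) \<partial>lborel) = ennreal (b ^ CARD('n) * vol K * fact CARD('n) / a ^ Suc CARD('n))" .
  have F0: "0 \<le> F z" for z by (simp add: F_def)
  have intF: "integrable lborel F" "integral\<^sup>L lborel F = b ^ CARD('n) * vol K * fact CARD('n) / a ^ Suc CARD('n)"
    using ab F0 nnF by (auto intro!: integrable_nn_integral_ennreal)
  obtain T T' :: "real \<Rightarrow> real" where T: "\<And>t. (T has_real_derivative T' t) (at t)" "\<And>t. 0 < T' t"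
    and Tpos: "\<And>t. 0 < T t"
    and T2: "\<And>t. exp (- T t) * T' t = 1 * std_normal_density t" using exponential_transport by blast
  have "1 ^ CARD('n option) \<le> integral\<^sup>L lborel F"
  proof (rule barthe_inequality[OF _ _ _ _ T T2 _ intF(1) F0, of "v ` S" d])
    show "finite (v ` S)" using S by simp
    show "norm z = 1" if z: "z \<in> v ` S" for z
    proof -
      obtain u where u: "u \<in> S" "z = v u" using z by blast
      have "u \<bullet> u = 1" using S(3)[OF u(1)] by (simp add: norm_eq_1)
      then have "z \<bullet> z = (b\<^sup>2 + 1) / a\<^sup>2"
        by (simp add: u v_def inner_vec_append power2_eq_square add_divide_distrib)
      then show ?thesis using ab by (simp add: norm_eq_1)
    qed
    show "0 \<le> d z" if "z \<in> v ` S" for z using that S(4) by (auto simp: dv)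
    show "(\<Sum>z\<in>v ` S. (d z * (z \<bullet> x)) *\<^sub>R z) = x" for x
    proof -
      have inner: "v u \<bullet> x = (b / a) * (u \<bullet> front x) + x $ None / a" for u
        by (simp add: v_def inner_vec_append)
      \<comment> \<open>Centredness removes the mixed terms between the old coordinates and the new
        one.\<close>
      have cf: "(\<Sum>u\<in>S. c u * (u \<bullet> y)) = 0" for y
        using arg_cong[OF cent, of "\<lambda>z. z \<bullet> y"] by (simp add: inner_sum_left)
      have ci: "(\<Sum>u\<in>S. c u * u $ i) = 0" for i
        using arg_cong[OF cent, of "\<lambda>z. z $ i"] by (simp add: sum_component)
      have cc: "(\<Sum>u\<in>S. c u * (u \<bullet> front x) * u $ i) = x $ Some i" for i
        using arg_cong[OF iso[of "front x"], of "\<lambda>z. z $ i"] by (simp add: sum_component front_def)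
      have "(\<Sum>z\<in>v ` S. (d z * (z \<bullet> x)) *\<^sub>R z) $ k = x $ k" for k
      proof (cases k)
        case None
        have "(\<Sum>z\<in>v ` S. (d z * (z \<bullet> x)) *\<^sub>R z) $ k
          = (\<Sum>u\<in>S. (a\<^sup>2 / b\<^sup>2) * (b / a) * (1 / a) * (c u * (u \<bullet> front x)) + (a\<^sup>2 / b\<^sup>2) * (1 / a)\<^sup>2 * x $ None * c u)"
          unfolding None sum.reindex[OF inj] sum_component
          by (intro sum.cong) (simp_all add: dv inner v_nth power2_eq_square algebra_simps)
        also have "\<dots> = (a\<^sup>2 / b\<^sup>2) * (b / a) * (1 / a) * (\<Sum>u\<in>S. c u * (u \<bullet> front x))
           + (a\<^sup>2 / b\<^sup>2) * (1 / a)\<^sup>2 * x $ None * (\<Sum>u\<in>S. c u)"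
          by (simp only: sum.distrib sum_distrib_left)
        also have "\<dots> = (a\<^sup>2 / b\<^sup>2) * (1 / a)\<^sup>2 * x $ None * b\<^sup>2"
          by (simp add: cf sumc ab(4))
        also have "\<dots> = x $ k" using ab(1,2) by (simp add: None field_simps)
        finally show ?thesis .
      next
        case (Some i)
        have "(\<Sum>z\<in>v ` S. (d z * (z \<bullet> x)) *\<^sub>R z) $ k
          = (\<Sum>u\<in>S. (a\<^sup>2 / b\<^sup>2) * (b / a)\<^sup>2 * (c u * (u \<bullet> front x) * u $ i) + (a\<^sup>2 / b\<^sup>2) * (b / a) * (1 / a) * x $ None * (c u * u $ i))"
          unfolding Some sum.reindex[OF inj] sum_component
          by (intro sum.cong) (simp_all add: dv inner v_nth power2_eq_square algebra_simps)
        also have "\<dots> = (a\<^sup>2 / b\<^sup>2) * (b / a)\<^sup>2 * (\<Sum>u\<in>S. c u * (u \<bullet> front x) * u $ i)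
            + (a\<^sup>2 / b\<^sup>2) * (b / a) * (1 / a) * x $ None * (\<Sum>u\<in>S. c u * u $ i)"
          by (simp only: sum.distrib sum_distrib_left)
        also have "\<dots> = x $ k" unfolding cc ci using ab(1,2) by (simp add: Some field_simps)
        finally show ?thesis .
      qed
      then show ?thesis by (simp add: vec_eq_iff)
    qed
    fix y :: "real^'n option"
    define w where "w u = d (v u) * T (v u \<bullet> y)" for u
    define s where "s = (\<Sum>u\<in>S. w u)"
    define X where "X = (\<Sum>z\<in>v ` S. (d z * T (z \<bullet> y)) *\<^sub>R z)"
    have w: "0 \<le> w u" if "u \<in> S" for u
      using S(4)[OF that] Tpos[of "v u \<bullet> y"] by (simp add: w_def dv)
    \<comment> \<open>Strictness matters: \<open>F\<close> vanishes at height 0, and the weights are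
      normalized by \<open>s\<close>. It holds because \<open>T\<close> is positive and the weights
      \<open>c\<close> sum to n.\<close>
    have "0 < s"
    proof -
      have "\<exists>u\<in>S. c u \<noteq> 0"
        using sumc by (metis sum.neutral of_nat_eq_0_iff zero_less_card_finite less_irrefl)
      then obtain u where u: "u \<in> S" "0 < c u" using S(4) by (metis order_le_less)
      then have "0 < w u" using Tpos[of "v u \<bullet> y"] ab by (simp add: w_def dv)
      also have "w u \<le> s" unfolding s_def by (rule member_le_sum) (use u S w in auto)
      finally show ?thesis .
    qed
    \<comment> \<open>\<open>X\<close> has height \<open>s / a\<close>, and rescaling its front part
      by \<open>b\<close> times that height gives a convex combination of contact points. Thus
      \<open>X\<close> lies in the cone, where \<open>F X\<close> is exactly
      \<open>exp (- s)\<close>.\<close>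
    have X1: "X $ None = s / a"
      unfolding X_def sum.reindex[OF inj] sum_component s_def sum_divide_distrib
      by (intro sum.cong) (simp_all add: w_def v_nth)
    have X2: "front X = (b / a * s) *\<^sub>R (\<Sum>u\<in>S. (w u / s) *\<^sub>R u)"
    proof -
      have "front X $ i = ((b / a * s) *\<^sub>R (\<Sum>u\<in>S. (w u / s) *\<^sub>R u)) $ i" for i
        unfolding front_def X_def sum.reindex[OF inj] vec_lambda_beta sum_component vector_scaleR_component real_scaleR_def sum_distrib_left
        using \<open>0 < s\<close> by (intro sum.cong) (simp_all add: w_def v_nth)
      then show ?thesis by (simp add: vec_eq_iff)
    qed
    have "(\<Sum>u\<in>S. (w u / s) *\<^sub>R u) \<in> K"
      using S \<open>0 < s\<close> w \<open>convex K\<close>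
      by (intro convex_sum) (auto simp: sum_divide_distrib[symmetric] s_def[symmetric])
    then have "F X = exp (- s)"
      using \<open>0 < s\<close> ab by (simp add: F_def X1 X2)
    moreover have "(\<Sum>z\<in>v ` S. d z * T (z \<bullet> y)) = s"
      by (simp add: sum.reindex[OF inj] s_def w_def)
    ultimately show "exp (- (\<Sum>z\<in>v ` S. d z * T (z \<bullet> y))) \<le> F (\<Sum>z\<in>v ` S. (d z * T (z \<bullet> y)) *\<^sub>R z)"
      by (simp add: X_def)
  qed simp
  then have "1 \<le> b ^ CARD('n) * vol K * fact CARD('n) / a ^ Suc CARD('n)" by (simp only: intF(2) power_one)
  then have "a ^ Suc CARD('n) \<le> b ^ CARD('n) * vol K * fact CARD('n)"
    using zero_less_power[OF ab(1), of "Suc CARD('n)"] by (simp add: pos_le_divide_eq del: power_Suc)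
  moreover have "0 < fact CARD('n) * b ^ CARD('n)" using ab by simp
  ultimately show ?thesis
    unfolding a_def[symmetric] b_def[symmetric] by (subst pos_divide_le_eq) (simp_all add: mult_ac)
qed

section \<open>Polar bodies\<close>

text \<open>Allows every bound for \<open>K\<close> to be applied to the polar body as well.\<close>

lemma polar_body_props:
  fixes K :: "(real^'n) set"
  assumes "bounded K" "0 \<in> interior K"
  shows "compact (polar_body K)" "convex (polar_body K)" "0 \<in> interior (polar_body K)"
proof -
  have eq: "polar_body K = (\<Inter>y\<in>K. {x. y \<bullet> x \<le> 1})"
    by (auto simp: polar_body_def inner_commute)
  show "convex (polar_body K)" unfolding eq by (intro convex_INT convex_halfspace_le)
  obtain r where r: "0 < r" "cball 0 r \<subseteq> K" using assms(2) by (auto simp: mem_interior_cball)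
  have "norm x \<le> 1 / r" if x: "x \<in> polar_body K" for x
  proof (cases "x = 0")
    case False
    have "(r / norm x) *\<^sub>R x \<in> K" using r False by (intro subsetD[OF r(2)]) auto
    then have "x \<bullet> ((r / norm x) *\<^sub>R x) \<le> 1" using x unfolding polar_body_def by blast
    then have "r * norm x \<le> 1" using False by (simp add: dot_square_norm power2_eq_square)
    then show ?thesis using r by (simp add: field_simps)
  qed (use r in auto)
  then have "bounded (polar_body K)" unfolding bounded_iff by blast
  moreover have "closed (polar_body K)" unfolding eq by (intro closed_INT ballI closed_halfspace_le)
  ultimately show "compact (polar_body K)" by (simp add: compact_eq_bounded_closed)
  obtain R where R: "0 < R" "\<And>x. x \<in> K \<Longrightarrow> norm x \<le> R"
    using assms(1) by (auto simp: bounded_pos)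
  have "cball 0 (1 / R) \<subseteq> polar_body K"
  proof
    fix x :: "real^'n" assume "x \<in> cball 0 (1 / R)"
    then have x: "norm x \<le> 1 / R" by simp
    show "x \<in> polar_body K" unfolding polar_body_def
    proof (clarify)
      fix y assume "y \<in> K"
      have "x \<bullet> y \<le> norm x * norm y" by (rule norm_cauchy_schwarz)
      also have "\<dots> \<le> 1 / R * R" using x R(2)[OF \<open>y \<in> K\<close>] R(1) by (intro mult_mono) auto
      finally show "x \<bullet> y \<le> 1" using R(1) by simp
    qed
  qed
  then show "0 \<in> interior (polar_body K)" using R(1) by (auto simp: mem_interior_cball intro!: exI[of _ "1 / R"])
qed

text \<open>The level \<open>b\<close> of a separating hyperplane is negative because 0 lies in
  \<open>K\<close>. Dividing by it normalizes the level to 1 and reverses the inequalities.\<close>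

lemma polar_separates:
  fixes K :: "(real^'n) set"
  assumes "closed K" "convex K" "0 \<in> K" "z \<notin> K"
  obtains y where "y \<in> polar_body K" "1 < y \<bullet> z"
proof -
  obtain a b where a: "a \<bullet> z < b" "\<And>x. x \<in> K \<Longrightarrow> b < a \<bullet> x"
    using separating_hyperplane_closed_point[OF assms(2,1,4)] by blast
  have b: "b < 0" using a(2)[OF \<open>0 \<in> K\<close>] by simp
  show ?thesis
  proof (rule that)
    show "(1 / b) *\<^sub>R a \<in> polar_body K"
      using a(2) b by (auto simp: polar_body_def divide_le_eq less_imp_le)
    show "1 < ((1 / b) *\<^sub>R a) \<bullet> z" using a(1) b by (simp add: less_divide_eq)
  qed
qed

lemma bipolar:
  fixes K :: "(real^'n) set"
  assumes "closed K" "convex K" "0 \<in> K"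
  shows "polar_body (polar_body K) = K"
proof
  show "K \<subseteq> polar_body (polar_body K)" by (auto simp: polar_body_def inner_commute)
  show "polar_body (polar_body K) \<subseteq> K"
  proof
    fix z assume z: "z \<in> polar_body (polar_body K)"
    show "z \<in> K"
    proof (rule ccontr)
      assume "z \<notin> K"
      then obtain y where "y \<in> polar_body K" "1 < y \<bullet> z" by (rule polar_separates[OF assms])
      then show False using z by (force simp: polar_body_def inner_commute)
    qed
  qed
qed

lemma inner_transpose_mult: "(transpose M *v z) \<bullet> x = z \<bullet> ((M :: real^'n^'n) *v x)"
  by (metis dot_lmul_matrix vector_transpose_matrix transpose_transpose transpose_matrix_vector)

text \<open>Together with \<open>bipolar\<close> it shows that \<open>K\<close> is a centred
  ellipsoid if its polar is, so the strict case passes to the polar body. The polar is the image of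
  the unit ball under \<open>transpose M\<close>.\<close>

lemma polar_of_ellipsoid:
  fixes E :: "(real^'n) set"
  assumes "ellipsoid_at 0 E"
  shows "ellipsoid_at 0 (polar_body E)"
proof -
  obtain M :: "real^'n^'n" where M: "invertible M" and E: "E = {x. norm (M *v x - M *v 0) \<le> 1}"
    by (rule ellipsoid_atE[OF assms])
  obtain A :: "real^'n^'n" where A: "M ** A = mat 1" "A ** M = mat 1" using M by (auto simp: invertible_def)
  have "polar_body E = (\<lambda>x. 0 + transpose M *v x) ` cball 0 1"
  proof (intro equalityI subsetI)
    fix y assume y: "y \<in> polar_body E"
    define w where "w = transpose A *v y"
    have "transpose M ** transpose A = mat 1" by (simp add: matrix_transpose_mul[symmetric] A transpose_mat)
    then have yw: "y = transpose M *v w" by (simp only: w_def matrix_vector_mul_assoc matrix_vector_mul_lid)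
    have "norm w \<le> 1"
    proof (cases "w = 0")
      case False
      let ?v = "(1 / norm w) *\<^sub>R w"
      have "A *v ?v \<in> E" using False by (simp add: E matrix_vector_mul_assoc A)
      then have "y \<bullet> (A *v ?v) \<le> 1" using y unfolding polar_body_def by blast
      also have "y \<bullet> (A *v ?v) = w \<bullet> ?v"
        by (simp only: yw inner_transpose_mult matrix_vector_mul_assoc A matrix_vector_mul_lid)
      finally have "w \<bullet> ?v \<le> 1" .
      then show ?thesis using False by (simp add: dot_square_norm power2_eq_square)
    qed simp
    then show "y \<in> (\<lambda>x. 0 + transpose M *v x) ` cball 0 1" using yw by auto
  next
    fix y assume "y \<in> (\<lambda>x. 0 + transpose M *v x) ` cball 0 1"
    then obtain w where w: "norm w \<le> 1" "y = transpose M *v w" by auto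
    have "y \<bullet> x \<le> 1" if "x \<in> E" for x
    proof -
      have "y \<bullet> x \<le> norm w * norm (M *v x)" unfolding w inner_transpose_mult by (rule norm_cauchy_schwarz)
      also have "\<dots> \<le> 1" using w that by (intro mult_le_one) (auto simp: E)
      finally show ?thesis .
    qed
    then show "y \<in> polar_body E" by (simp add: polar_body_def)
  qed
  moreover have "invertible (transpose M)" using M by (simp add: invertible_det_nz det_transpose)
  ultimately show ?thesis unfolding ellipsoid_at_def by blast
qed

text \<open>The polar body of the unit ball centred at \<open>b\<close>.\<close>

definition polar_ball :: "'a::euclidean_space \<Rightarrow> 'a set"
  where "polar_ball b = {z. norm z + z \<bullet> b \<le> 1}"

lemma norm_add_inner_pos:
  assumes "norm b < 1" "z \<noteq> (0::'a::real_inner)"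
  shows "0 < norm z + z \<bullet> b"
proof -
  have "- (z \<bullet> b) \<le> norm z * norm b" using norm_cauchy_schwarz[of z "- b"] by simp
  also have "\<dots> < norm z" using assms by simp
  finally show ?thesis by simp
qed

lemma compact_polar_ball:
  fixes b :: "'a::euclidean_space"
  assumes "norm b < 1"
  shows "compact (polar_ball b)"
proof -
  have "norm z \<le> 1 / (1 - norm b)" if "z \<in> polar_ball b" for z
  proof -
    have "- (z \<bullet> b) \<le> norm z * norm b" using norm_cauchy_schwarz[of z "- b"] by simp
    then have "norm z * (1 - norm b) \<le> 1" using that by (simp add: polar_ball_def algebra_simps)
    then show ?thesis using assms by (simp add: field_simps)
  qed
  then have "bounded (polar_ball b)" unfolding bounded_iff by blast
  moreover have "closed (polar_ball b)" unfolding polar_ball_def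
    by (intro closed_Collect_le continuous_intros)
  ultimately show ?thesis by (simp add: compact_eq_bounded_closed)
qed

text \<open>By homogeneity \<open>z /\<^sub>R t\<close> lies in the set exactly when
  \<open>t\<close> is at least \<open>norm z + z \<bullet> b\<close>, so this sum is the gauge. Its
  positivity for nonzero \<open>z\<close> excludes nonpositive \<open>t\<close>.\<close>

lemma expgauge_polar_ball:
  assumes "norm b < 1" "z \<noteq> 0"
  shows "expgauge (polar_ball b) z = ennreal (exp (- (norm z + z \<bullet> b)))"
proof -
  have "expgauge (polar_ball b) z = (\<integral>\<^sup>+ t. ennreal (exp (- t)) * indicator {norm z + z \<bullet> b..} t \<partial>lborel)"
    unfolding expgauge_def
  proof (rule nn_integral_cong)
    fix t :: real
    have "0 < t \<and> z /\<^sub>R t \<in> polar_ball b \<longleftrightarrow> norm z + z \<bullet> b \<le> t"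
    proof (cases "0 < t")
      case True
      have "norm (z /\<^sub>R t) + (z /\<^sub>R t) \<bullet> b = (norm z + z \<bullet> b) / t" using True by (simp add: field_simps)
      then show ?thesis using True by (simp add: polar_ball_def divide_le_eq)
    qed (use norm_add_inner_pos[OF assms] in auto)
    then show "ennreal (exp (- t)) * indicator {0<..} t * indicator (polar_ball b) (z /\<^sub>R t)
        = ennreal (exp (- t)) * indicator {norm z + z \<bullet> b..} t"
      by (auto split: split_indicator)
  qed
  also have "\<dots> = (\<integral>\<^sup>+ t. ennreal (exp (- t)) * indicator {norm z + z \<bullet> b<..} t \<partial>lborel)"
    by (intro nn_integral_cong_AE eventually_mono[OF AE_lborel_singleton[of "norm z + z \<bullet> b"]])
      (auto split: split_indicator)
  finally show ?thesis by (simp only: nn_integral_exp_greaterThan)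
qed

lemma integral_exp_norm_inner:
  fixes b :: "'a::euclidean_space"
  assumes "norm b < 1"
  shows "integrable lborel (\<lambda>z. exp (- (norm z + z \<bullet> b)))"
    "integral\<^sup>L lborel (\<lambda>z. exp (- (norm z + z \<bullet> b))) = fact DIM('a) * measure lebesgue (polar_ball b)"
proof -
  have "(\<integral>\<^sup>+ z. ennreal (exp (- (norm z + z \<bullet> b))) \<partial>lborel) = (\<integral>\<^sup>+ z. expgauge (polar_ball b) z \<partial>lborel)"
    by (intro nn_integral_cong_AE eventually_mono[OF AE_lborel_singleton[of 0]])
      (simp add: expgauge_polar_ball[OF assms])
  also have "\<dots> = ennreal (fact DIM('a) * measure lebesgue (polar_ball b))"
    by (rule nn_integral_expgauge[OF compact_polar_ball[OF assms]])
  finally show "integrable lborel (\<lambda>z. exp (- (norm z + z \<bullet> b)))"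
    "integral\<^sup>L lborel (\<lambda>z. exp (- (norm z + z \<bullet> b))) = fact DIM('a) * measure lebesgue (polar_ball b)"
    by (auto intro!: integrable_nn_integral_ennreal)
qed

lemma measure_polar_ball_uminus:
  fixes b :: "'a::euclidean_space"
  shows "measure lebesgue (polar_ball (- b)) = measure lebesgue (polar_ball b)"
proof -
  have "polar_ball (- b) = (\<lambda>x. (-1) *\<^sub>R x + 0) ` polar_ball b"
    by (auto simp: polar_ball_def image_iff intro!: exI[of _ "- x" for x])
  then have "emeasure lebesgue (polar_ball (- b)) = emeasure lebesgue (polar_ball b)"
    by (simp only: emeasure_lebesgue_affine) simp
  then show ?thesis by (simp add: measure_def)
qed

lemma polar_ball_0: "polar_ball 0 = cball 0 1"
  by (auto simp: polar_ball_def)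

text \<open>Averaging over \<^term>\<open>b\<close> and \<^term>\<open>- b\<close> replaces the weight \<open>exp (- (z \<bullet> b))\<close> by
  \<open>cosh (z \<bullet> b) \<ge> 1\<close>.\<close>

lemma measure_polar_ball_ge:
  fixes b :: "'a::euclidean_space"
  assumes "norm b < 1"
  shows "measure lebesgue (cball 0 1 :: 'a set) \<le> measure lebesgue (polar_ball b)"
    "b \<noteq> 0 \<Longrightarrow> measure lebesgue (cball 0 1 :: 'a set) < measure lebesgue (polar_ball b)"
proof -
  define D where "D z = exp (- (norm z + z \<bullet> b)) + exp (- (norm z + z \<bullet> (- b))) - 2 * exp (- (norm z + z \<bullet> 0))" for z :: 'a
  \<comment> \<open>The excess of the averaged weight over the centred one is a perfect square,
    which gives both the inequality and its equality case.\<close>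
  have D: "D z = exp (- norm z) * (exp ((z \<bullet> b) / 2) - exp (- (z \<bullet> b) / 2))\<^sup>2" for z
    by (simp add: D_def power2_diff exp_add[symmetric] exp_double[symmetric] algebra_simps)
  have b': "norm (- b) < 1" "norm (0::'a) < 1" using assms by auto
  have i: "integrable lborel D" unfolding D_def
    by (intro Bochner_Integration.integrable_add Bochner_Integration.integrable_diff integrable_mult_right
        integral_exp_norm_inner assms b')
  have "integral\<^sup>L lborel D = fact DIM('a) * (2 * (measure lebesgue (polar_ball b) - measure lebesgue (cball 0 1 :: 'a set)))"
    unfolding D_def
    by (simp only: Bochner_Integration.integral_add Bochner_Integration.integral_diff integral_mult_right_zero
        Bochner_Integration.integrable_add integrable_mult_right
        integral_exp_norm_inner[OF assms] integral_exp_norm_inner[OF b'(1)] integral_exp_norm_inner[OF b'(2)]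
        measure_polar_ball_uminus polar_ball_0) (simp add: algebra_simps)
  moreover have D0: "0 \<le> D z" for z by (simp add: D)
  then have "0 \<le> integral\<^sup>L lborel D" by simp
  moreover have "0 \<le> x" if "0 \<le> fact DIM('a) * (2 * x)" for x :: real
    using that mult_pos_neg[of "fact DIM('a)" "2 * x"] fact_gt_zero[where 'a = real, of "DIM('a)"] by linarith
  ultimately show "measure lebesgue (cball 0 1 :: 'a set) \<le> measure lebesgue (polar_ball b)"
    by (metis diff_ge_0_iff_ge)
  assume "b \<noteq> 0"
  show "measure lebesgue (cball 0 1 :: 'a set) < measure lebesgue (polar_ball b)"
  proof (rule ccontr)
    assume "\<not> ?thesis"
    then have "integral\<^sup>L lborel D = 0"
      using \<open>measure lebesgue (cball 0 1 :: 'a set) \<le> measure lebesgue (polar_ball b)\<close>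
        \<open>integral\<^sup>L lborel D = _\<close> by auto
    \<comment> \<open>\<open>D\<close> vanishes only on the hyperplane orthogonal to
      \<open>b\<close>, a null set, so it cannot vanish almost everywhere.\<close>
    then have "AE z in lborel. D z = 0"
      using integral_nonneg_eq_0_iff_AE[OF i] D0 by simp
    then have "AE z in lborel. b \<bullet> z = 0"
      by (rule eventually_mono) (simp add: D inner_commute)
    then have "AE z in lebesgue. z \<in> {z. b \<bullet> z = 0}" using AE_completion by fastforce
    then have "negligible (- {z. b \<bullet> z = 0})"
      by (simp add: negligible_iff_null_sets Compl_eq AE_iff_null_sets)
    moreover have "negligible {z. b \<bullet> z = 0}" using \<open>b \<noteq> 0\<close> by (simp add: negligible_hyperplane)
    ultimately have "negligible (- {z. b \<bullet> z = 0} \<union> {z. b \<bullet> z = 0})" by (rule negligible_Un)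
    then show False by (simp add: Compl_partition2)
  qed
qed

text \<open>A point of \<open>B\<close> outside the closed set \<open>A\<close> is a limit of
  interior points of \<open>B\<close>, so \<open>interior B - A\<close> is a nonempty open set and
  has positive volume.\<close>

lemma vol_strict_mono:
  fixes A B :: "(real^'n) set"
  assumes "compact A" "compact B" "convex B" "interior B \<noteq> {}" "A \<subset> B"
  shows "vol A < vol B"
proof -
  obtain y where y: "y \<in> B" "y \<notin> A" using assms(5) by blast
  have "y \<in> closure (interior B)"
    using y(1) convex_closure_interior[OF assms(3,4)] closure_subset by blast
  moreover have "open (- A)" using assms(1) by (simp add: compact_imp_closed open_Compl)
  ultimately have ne: "interior B - A \<noteq> {}"
    using y(2) by (metis Compl_iff Diff_eq Int_commute closure_iff_nhds_not_empty subset_refl)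
  let ?W = "interior B - A"
  have W: "open ?W" using assms(1) by (simp add: compact_imp_closed open_Diff)
  have "?W \<in> lmeasurable"
    using W assms(2) by (intro lmeasurable_open) (auto intro: bounded_subset compact_imp_bounded interior_subset)
  then have "0 < vol ?W"
    using W ne open_not_negligible[OF W ne] by (simp add: negligible_iff_measure zero_less_measure_iff)
  moreover have "vol (A \<union> ?W) = vol A + vol ?W"
    using \<open>?W \<in> lmeasurable\<close> assms(1) by (intro measure_Un2[THEN trans]) (auto simp: lmeasurable_compact Diff_idemp)
  moreover have "vol (A \<union> ?W) \<le> vol B"
    using assms \<open>?W \<in> lmeasurable\<close> interior_subset[of B]
    by (intro measure_mono_fmeasurable) (auto simp: lmeasurable_compact fmeasurableD)
  ultimately show ?thesis by linarith
qed

text \<open>Stated for every admissible pair with nonzero determinant: besides maximal pairs it is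
  applied to the pair that represents a centred ellipsoid exactly.\<close>

theorem vol_polar_ge:
  fixes K :: "(real^'n) set"
  assumes K: "compact K" "convex K" "0 \<in> interior K"
    and M: "(M, b) \<in> admissible K" "det M \<noteq> 0"
  shows "\<bar>det M\<bar> * vol (cball 0 1 :: (real^'n) set) \<le> vol (polar_body K)"
    "\<not> ellipsoid_at 0 K \<Longrightarrow> \<bar>det M\<bar> * vol (cball 0 1 :: (real^'n) set) < vol (polar_body K)"
proof -
  let ?\<omega> = "vol (cball 0 1 :: (real^'n) set)"
  have inv: "invertible M" using M(2) by (simp add: invertible_det_nz)
  then have invT: "invertible (transpose M)" by (simp add: invertible_det_nz det_transpose)
  have adm: "norm (M *v x - b) \<le> 1" if "x \<in> K" for x using M(1) that by (auto simp: admissible_def)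
  \<comment> \<open>The origin lies strictly inside the ellipsoid. A step from it away from the
    centre \<open>c\<close> stays in \<open>K\<close> and stretches \<open>- b\<close> by the factor
    \<open>1 + r / norm c\<close>, while the norm remains at most 1.\<close>
  have b: "norm b < 1"
  proof (cases "b = 0")
    case False
    obtain c where c: "M *v c = b"
      using inv by (metis invertible_def matrix_vector_mul_assoc matrix_vector_mul_lid)
    then have "c \<noteq> 0" using False by auto
    obtain r where r: "0 < r" "cball 0 r \<subseteq> K" using K(3) by (auto simp: mem_interior_cball)
    have "(- (r / norm c)) *\<^sub>R c \<in> K" using r \<open>c \<noteq> 0\<close> by (intro subsetD[OF r(2)]) auto
    then have "norm (M *v ((- (r / norm c)) *\<^sub>R c) - b) \<le> 1" by (rule adm)
    also have "M *v ((- (r / norm c)) *\<^sub>R c) - b = (- (1 + r / norm c)) *\<^sub>R b"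
      by (simp only: matrix_vector_mult_scaleR c) (simp add: algebra_simps)
    also have "norm \<dots> = (1 + r / norm c) * norm b"
      unfolding norm_scaleR abs_minus_cancel using r by (subst abs_of_nonneg) auto
    finally have "(1 + r / norm c) * norm b \<le> 1" .
    moreover have "norm b < (1 + r / norm c) * norm b" using r False \<open>c \<noteq> 0\<close> by simp
    ultimately show ?thesis by linarith
  qed simp
  let ?Z = "(*v) (transpose M) ` polar_ball b"
  have sub: "?Z \<subseteq> polar_body K"
  proof (clarify)
    fix z assume z: "z \<in> polar_ball b"
    have "(transpose M *v z) \<bullet> x \<le> 1" if "x \<in> K" for x
    proof -
      have "(transpose M *v z) \<bullet> x = z \<bullet> (M *v x - b) + z \<bullet> b"
        unfolding inner_transpose_mult by (simp add: inner_diff_right)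
      also have "z \<bullet> (M *v x - b) \<le> norm z * norm (M *v x - b)" by (rule norm_cauchy_schwarz)
      also have "\<dots> \<le> norm z" using adm[OF that] by (simp add: mult_left_le)
      finally show ?thesis using z by (simp add: polar_ball_def)
    qed
    then show "transpose M *v z \<in> polar_body K" by (simp add: polar_body_def)
  qed
  note P = polar_body_props[OF compact_imp_bounded[OF K(1)] K(3)]
  have cZ: "compact ?Z"
    by (intro compact_continuous_image linear_continuous_on matrix_vector_mul_bounded_linear compact_polar_ball b)
  have volZ: "vol ?Z = \<bar>det M\<bar> * vol (polar_ball b)"
    using vol_matrix_image[OF compact_polar_ball[OF b] invT] by (simp add: det_transpose)
  have le: "vol ?Z \<le> vol (polar_body K)"
    using sub cZ P(1) by (intro measure_mono_fmeasurable) (auto simp: lmeasurable_compact fmeasurableD)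
  have "\<bar>det M\<bar> * ?\<omega> \<le> vol ?Z"
    unfolding volZ by (intro mult_left_mono measure_polar_ball_ge(1) b) simp
  then show "\<bar>det M\<bar> * ?\<omega> \<le> vol (polar_body K)" using le by linarith
  assume ne: "\<not> ellipsoid_at 0 K"
  show "\<bar>det M\<bar> * ?\<omega> < vol (polar_body K)"
  proof (cases "b = 0")
    case False
    then have "\<bar>det M\<bar> * ?\<omega> < vol ?Z"
      unfolding volZ using M(2) by (intro mult_strict_left_mono measure_polar_ball_ge(2) b) simp_all
    then show ?thesis using le by linarith
  next
    \<comment> \<open>Now the ball estimate may be an equality, so strictness must come from
      \<open>K\<close> being smaller than \<open>?E\<close>. A point of \<open>?E\<close> outside
      \<open>K\<close> is separated by some \<open>y\<close> in the polar of \<open>K\<close>, which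
      then cannot lie in the polar of \<open>?E\<close>.\<close>
    case True
    let ?E = "{x. norm (M *v x - 0) \<le> 1}"
    have "ellipsoid_at 0 ?E" using ellipsoid_at_norm_le(1)[OF inv, of 0 0] by simp
    with ne have "K \<noteq> ?E" by auto
    moreover have "K \<subseteq> ?E" using adm True by auto
    ultimately obtain x where x: "x \<in> ?E" "x \<notin> K" by blast
    obtain y where y: "y \<in> polar_body K" "1 < y \<bullet> x"
      by (rule polar_separates[OF compact_imp_closed[OF K(1)] K(2) _ x(2)]) (use K(3) interior_subset in auto)
    have "y \<notin> ?Z"
    proof
      assume "y \<in> ?Z"
      then obtain z where z: "norm z \<le> 1" "y = transpose M *v z" by (auto simp: True polar_ball_0)
      have "y \<bullet> x \<le> norm z * norm (M *v x)" unfolding z inner_transpose_mult by (rule norm_cauchy_schwarz)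
      also have "\<dots> \<le> 1" using z x(1) by (intro mult_le_one) auto
      finally show False using y(2) by simp
    qed
    then have "?Z \<subset> polar_body K" using sub y(1) by blast
    then have "vol ?Z < vol (polar_body K)" using P by (intro vol_strict_mono cZ) auto
    then show ?thesis unfolding volZ by (simp add: True polar_ball_0)
  qed
qed

section \<open>The volume product\<close>

text \<open>The expression is the volume of the cross-polytope divided by that of the unit ball. The
  step is 2 because the Gamma recursion shifts n / 2 by 1.\<close>

lemma cross_polytope_step:
  "2 ^ (n + 2) * Gamma (real (n + 2) / 2 + 1) / (fact (n + 2) * pi powr (real (n + 2) / 2))
    = (2 ^ n * Gamma (real n / 2 + 1) / (fact n * pi powr (real n / 2))) * (2 / ((real n + 1) * pi))"
proof -
  have "real n / 2 + 1 \<notin> \<int>\<^sub>\<le>\<^sub>0" by (auto dest: nonpos_Ints_nonpos)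
  then have G: "Gamma (real (n + 2) / 2 + 1) = (real n / 2 + 1) * Gamma (real n / 2 + 1)"
    using Gamma_plus1[of "real n / 2 + 1"] by (simp add: add_divide_distrib add_ac)
  have P: "pi powr (real (n + 2) / 2) = pi powr (real n / 2) * pi"
    by (simp add: add_divide_distrib powr_add)
  have F: "(fact (n + 2) :: real) = (real n + 2) * (real n + 1) * fact n" "(2::real) ^ (n + 2) = 4 * 2 ^ n"
    by (simp_all add: add_ac)
  have "4 * k * ((x / 2 + 1) * g) / ((x + 2) * (x + 1) * f * (p * q)) = k * g / (f * p) * (2 / ((x + 1) * q))"
    if "0 \<le> x" for k x g f p q :: real
  proof -
    have "4 * k * ((x / 2 + 1) * g) = (x + 2) * (2 * k * g)" by (simp add: algebra_simps)
    then have "4 * k * ((x / 2 + 1) * g) / ((x + 2) * (x + 1) * f * (p * q))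
      = ((x + 2) * (2 * k * g)) / ((x + 2) * ((x + 1) * f * (p * q)))" by (simp only: mult.assoc)
    also have "\<dots> = 2 * k * g / ((x + 1) * f * (p * q))" using that by (subst mult_divide_mult_cancel_left) auto
    finally show ?thesis by (simp add: mult_ac)
  qed
  then show ?thesis unfolding G P F by simp
qed

text \<open>The ratio equals 1 for n = 0 and n = 1, and each step of two dimensions multiplies it by
  a factor at most 1.\<close>

lemma cross_polytope_ratio_le_1:
  "2 ^ n * Gamma (real n / 2 + 1) / (fact n * pi powr (real n / 2)) \<le> 1"
proof (induction n rule: induct_nat_012)
  case 1
  have "Gamma (1 / 2 + 1) = 1 / 2 * (sqrt pi :: real)"
  proof -
    have "1 / 2 \<notin> (\<int>\<^sub>\<le>\<^sub>0 :: real set)" by (auto dest: nonpos_Ints_nonpos)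
    from Gamma_plus1[OF this] show ?thesis by (simp add: Gamma_one_half_real)
  qed
  then show ?case by (simp add: powr_half_sqrt)
next
  case (ge2 n)
  have "2 ^ n * Gamma (real n / 2 + 1) / (fact n * pi powr (real n / 2)) * (2 / ((real n + 1) * pi)) \<le> 1 * 1"
  proof (rule mult_mono[OF ge2(1)])
    have "2 \<le> 1 * pi" using pi_ge_two by simp
    also have "\<dots> \<le> (real n + 1) * pi" by (intro mult_right_mono) auto
    finally show "2 / ((real n + 1) * pi) \<le> 1" by (simp add: divide_le_eq)
  qed auto
  then show ?case using cross_polytope_step[of n] by simp
qed simp

lemma cross_polytope_ratio_less_1:
  assumes "2 \<le> n"
  shows "2 ^ n * Gamma (real n / 2 + 1) / (fact n * pi powr (real n / 2)) < 1"
proof -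
  obtain m where m: "n = m + 2" using assms by (metis add.commute le_Suc_ex)
  have "2 ^ m * Gamma (real m / 2 + 1) / (fact m * pi powr (real m / 2)) * (2 / ((real m + 1) * pi)) \<le> 1 * (2 / ((real m + 1) * pi))"
    by (intro mult_right_mono cross_polytope_ratio_le_1) auto
  also have "2 < 1 * pi" using pi_gt3 by simp
  then have "2 < (real m + 1) * pi"
    by (rule order_less_le_trans) (intro mult_right_mono, auto)
  then have "1 * (2 / ((real m + 1) * pi)) < 1" by (simp add: divide_less_eq)
  finally show ?thesis unfolding m cross_polytope_step .
qed

text \<open>Uses that \<open>(1 + 1 / real n) ^ n\<close> is at most e, hence at most 3, and that 3
  (n + 1) is at most 4^n from n = 2 on. For n = 1 equality holds.\<close>

lemma Suc_power_le: "real (n + 1) ^ (n + 1) \<le> 4 ^ n * real n ^ n" if "1 \<le> n"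
proof (cases "n = 1")
  case False
  with that have n: "2 \<le> n" by simp
  have "(1 + 1 / real n) ^ n \<le> exp (1 / real n) ^ n"
    by (intro power_mono exp_ge_add_one_self) auto
  also have "\<dots> = exp 1" using n by (simp add: exp_of_nat_mult[symmetric])
  also have "\<dots> \<le> 3" by (rule exp_le)
  finally have "(1 + 1 / real n) ^ n * real n ^ n \<le> 3 * real n ^ n" by (intro mult_right_mono) auto
  then have "real (n + 1) ^ n \<le> 3 * real n ^ n"
    using n by (simp add: power_mult_distrib[symmetric] distrib_right add.commute)
  then have "real (n + 1) ^ n * real (n + 1) \<le> (3 * real n ^ n) * real (n + 1)"
    by (intro mult_right_mono) auto
  also have "\<dots> = (3 * real (n + 1)) * real n ^ n" by simp
  also have "3 * real (n + 1) \<le> 4 ^ n"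
    using n by (induction n rule: nat_induct_at_least) auto
  then have "(3 * real (n + 1)) * real n ^ n \<le> 4 ^ n * real n ^ n" by (intro mult_right_mono) auto
  finally show ?thesis by (simp only: power_add power_one_right)
qed simp

text \<open>After division by n! this compares the regular simplex with the cross-polytope, both
  inscribed in the unit ball. Squaring reduces it to \<open>Suc_power_le\<close>.\<close>

lemma simplex_le_cross_polytope:
  assumes "1 \<le> n"
  shows "sqrt (real n + 1) ^ Suc n / sqrt (real n) ^ n \<le> 2 ^ n"
proof -
  have sq: "(sqrt x ^ k)\<^sup>2 = x ^ k" if "0 \<le> x" for x k
    using that by (simp add: power_mult[symmetric] mult.commute[of k 2]) (simp add: power_mult)
  have "(sqrt (real n + 1) ^ Suc n)\<^sup>2 = real (n + 1) ^ (n + 1)"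
    by (subst sq) (simp_all add: add.commute)
  also have "\<dots> \<le> 4 ^ n * real n ^ n" by (rule Suc_power_le[OF assms])
  also have "\<dots> = (2 ^ n * sqrt (real n) ^ n)\<^sup>2"
  proof -
    have "(4::real) ^ n = (2 ^ n)\<^sup>2"
      unfolding power2_eq_square power_mult_distrib[symmetric] by simp
    then show ?thesis unfolding power_mult_distrib[of "2 ^ n"] by (simp only: sq of_nat_0_le_iff)
  qed
  finally have "sqrt (real n + 1) ^ Suc n \<le> 2 ^ n * sqrt (real n) ^ n"
    by (rule power2_le_imp_le) simp
  then show ?thesis using assms by (simp add: divide_le_eq del: power_Suc)
qed

lemma simplex_powr:
  assumes "1 \<le> n"
  shows "(real n + 1) powr ((real n + 1) / 2) * G / (f * (real n * pi) powr (real n / 2))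
    = (sqrt (real n + 1) ^ Suc n / sqrt (real n) ^ n) * G / (f * pi powr (real n / 2))"
proof -
  have *: "x powr (real k / 2) = sqrt x ^ k" if "0 < x" for x k
    using that by (simp add: powr_realpow[symmetric] powr_half_sqrt[symmetric] powr_powr)
  have "(real n + 1) powr ((real n + 1) / 2) = sqrt (real n + 1) ^ Suc n"
    using *[of "real n + 1" "Suc n"] by (simp add: add.commute)
  moreover have "(real n * pi) powr (real n / 2) = sqrt (real n) ^ n * pi powr (real n / 2)"
    using assms by (subst powr_mult) (auto simp: *)
  ultimately show ?thesis by simp
qed

section \<open>Lower bounds for the volume product\<close>

lemma vol_unit_cball: "vol (cball 0 1 :: (real^'n) set) = pi powr (real CARD('n) / 2) / Gamma (real CARD('n) / 2 + 1)"
  by (simp add: content_cball unit_ball_vol_def)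

lemma vol_unit_cball_pos: "0 < vol (cball 0 1 :: (real^'n) set)"
  unfolding vol_unit_cball by (intro divide_pos_pos Gamma_real_pos) auto

lemma vol_pos:
  fixes K :: "(real^'n) set"
  assumes "compact K" "convex K" "0 \<in> interior K"
  shows "0 < vol K"
  using assms negligible_convex_interior[OF assms(2)] lmeasurable_compact[OF assms(1)]
  by (auto simp: negligible_iff_measure zero_less_measure_iff)

text \<open>For the Loewner pair the left-hand side is exactly \<open>vol K\<close> times the lower
  bound for the volume of the polar.\<close>

lemma vol_product_ge_evr:
  fixes K :: "(real^'n) set"
  assumes K: "compact K" "convex K" "0 \<in> interior K"
  shows "evr K ^ CARD('n) * (vol (cball 0 1 :: (real^'n) set))\<^sup>2 \<le> vol K * vol (polar_body K)"
    "\<not> ellipsoid_at 0 K \<Longrightarrow>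
      evr K ^ CARD('n) * (vol (cball 0 1 :: (real^'n) set))\<^sup>2 < vol K * vol (polar_body K)"
proof -
  let ?\<omega> = "vol (cball 0 1 :: (real^'n) set)"
  obtain M b where M: "(M, b) \<in> admissible K" "det M \<noteq> 0"
    and max: "\<And>N d. (N, d) \<in> admissible K \<Longrightarrow> \<bar>det N\<bar> \<le> \<bar>det M\<bar>"
    using lowner_exists[OF K(1,3)] by blast
  have evr: "evr K ^ CARD('n) = vol K * \<bar>det M\<bar> / ?\<omega>" by (rule evr_power[OF M max])
  have eq: "evr K ^ CARD('n) * ?\<omega>\<^sup>2 = vol K * (\<bar>det M\<bar> * ?\<omega>)"
    unfolding evr using vol_unit_cball_pos[where 'n = 'n] by (simp add: power2_eq_square)
  show "evr K ^ CARD('n) * ?\<omega>\<^sup>2 \<le> vol K * vol (polar_body K)"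
    unfolding eq by (intro mult_left_mono vol_polar_ge(1)[OF K M]) simp
  assume "\<not> ellipsoid_at 0 K"
  then show "evr K ^ CARD('n) * ?\<omega>\<^sup>2 < vol K * vol (polar_body K)"
    unfolding eq by (intro mult_strict_left_mono vol_polar_ge(2)[OF K M] vol_pos K) 
qed

text \<open>The map \<open>\<lambda>x. - b + M *v x\<close> carries the Loewner ellipsoid to the
  unit ball and multiplies volume by \<open>\<bar>det M\<bar>\<close>, so the bounds for John
  position can be pulled back.\<close>

lemma john_position:
  fixes K :: "(real^'n) set"
  assumes K: "compact K" "convex K" "0 \<in> interior K"
    and M: "(M, b) \<in> admissible K" "det M \<noteq> 0"
    and max: "\<And>N d. (N, d) \<in> admissible K \<Longrightarrow> \<bar>det N\<bar> \<le> \<bar>det M\<bar>"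
  shows "sqrt (real CARD('n) + 1) ^ Suc CARD('n) / (fact CARD('n) * sqrt (real CARD('n)) ^ CARD('n)) \<le> \<bar>det M\<bar> * vol K"
    "uminus ` K = K \<Longrightarrow> b = 0 \<Longrightarrow> 2 ^ CARD('n) / fact CARD('n) \<le> \<bar>det M\<bar> * vol K"
proof -
  let ?K = "(\<lambda>x. - b + M *v x) ` K"
  have inv: "invertible M" using M(2) by (simp add: invertible_det_nz)
  have vol: "vol ?K = \<bar>det M\<bar> * vol K" by (rule vol_affine_image[OF K(1) inv])
  have cpt: "compact ?K" by (intro compact_continuous_image K continuous_intros)
  have "?K = (+) (- b) ` (*v) M ` K" by (simp add: image_image)
  then have conv: "convex ?K" using K(2) by (simp add: convex_translation convex_linear_image)
  have ball: "?K \<subseteq> cball 0 1" using M(1) by (auto simp: admissible_def)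
  \<comment> \<open>A pair admissible for the image pulls back to
    \<open>(N ** M, N *v b + d)\<close>. Maximality of \<open>M\<close> and multiplicativity of the
    determinant then bound \<open>N\<close>.\<close>
  have "\<bar>det N\<bar> \<le> 1" if N: "(N, d) \<in> admissible ?K" for N d
  proof -
    have "norm ((N ** M) *v x - (N *v b + d)) \<le> 1" if "x \<in> K" for x
    proof -
      have "norm (N *v (- b + M *v x) - d) \<le> 1" using N that by (auto simp: admissible_def)
      moreover have "N *v (- b + M *v x) = (N ** M) *v x - N *v b"
        unfolding matrix_vector_mul_assoc[symmetric] matrix_vector_mult_diff_distrib[symmetric] by simp
      ultimately show ?thesis by (simp add: algebra_simps)
    qed
    then have "(N ** M, N *v b + d) \<in> admissible K" by (simp add: admissible_def)
    from max[OF this] show ?thesis using M(2) by (simp add: det_mul abs_mult)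
  qed
  then obtain S c where S: "finite S" "S \<subseteq> ?K" "\<And>u. u \<in> S \<Longrightarrow> norm u = 1" "\<And>u. u \<in> S \<Longrightarrow> 0 \<le> c u"
    and c: "(\<Sum>u\<in>S. c u *\<^sub>R u) = 0" "\<And>x. (\<Sum>u\<in>S. (c u * (u \<bullet> x)) *\<^sub>R u) = x"
    using john_decomposition[OF cpt ball] by blast
  show "sqrt (real CARD('n) + 1) ^ Suc CARD('n) / (fact CARD('n) * sqrt (real CARD('n)) ^ CARD('n)) \<le> \<bar>det M\<bar> * vol K"
    using vol_ge_simplex[OF cpt conv S c] unfolding vol .
  assume sym: "uminus ` K = K" and "b = 0"
  have "uminus ` ?K = (\<lambda>x. M *v x) ` uminus ` K"
    using \<open>b = 0\<close> by (simp add: image_image linear_neg[OF matrix_vector_mul_linear])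
  then have sym': "uminus ` ?K = ?K" using sym \<open>b = 0\<close> by simp
  have "0 \<in> K" using K(3) interior_subset by auto
  then have "0 \<in> ?K" using \<open>b = 0\<close> by (auto simp: image_iff intro!: bexI[of _ 0])
  from vol_ge_cross_polytope[OF cpt conv this sym' S c(2)]
  show "2 ^ CARD('n) / fact CARD('n) \<le> \<bar>det M\<bar> * vol K" unfolding vol .
qed

lemma vol_product_ge_simplex:
  fixes K :: "(real^'n) set"
  assumes K: "compact K" "convex K" "0 \<in> interior K"
  defines "q \<equiv> sqrt (real CARD('n) + 1) ^ Suc CARD('n) / (fact CARD('n) * sqrt (real CARD('n)) ^ CARD('n))"
  shows "q * vol (cball 0 1 :: (real^'n) set) \<le> vol K * vol (polar_body K)"
    "\<not> ellipsoid_at 0 K \<Longrightarrow> q * vol (cball 0 1 :: (real^'n) set) < vol K * vol (polar_body K)"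
proof -
  let ?\<omega> = "vol (cball 0 1 :: (real^'n) set)"
  obtain M b where M: "(M, b) \<in> admissible K" "det M \<noteq> 0"
    and max: "\<And>N d. (N, d) \<in> admissible K \<Longrightarrow> \<bar>det N\<bar> \<le> \<bar>det M\<bar>"
    using lowner_exists[OF K(1,3)] by blast
  have q: "q * ?\<omega> \<le> vol K * (\<bar>det M\<bar> * ?\<omega>)"
    using mult_right_mono[OF john_position(1)[OF K M max], where c = ?\<omega>] by (simp add: q_def mult_ac)
  also have "\<dots> \<le> vol K * vol (polar_body K)"
    by (intro mult_left_mono vol_polar_ge(1)[OF K M]) simp
  finally show "q * ?\<omega> \<le> vol K * vol (polar_body K)" .
  assume "\<not> ellipsoid_at 0 K"
  then have "vol K * (\<bar>det M\<bar> * ?\<omega>) < vol K * vol (polar_body K)"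
    by (intro mult_strict_left_mono vol_polar_ge(2)[OF K M] vol_pos K) 
  with q show "q * ?\<omega> < vol K * vol (polar_body K)" by linarith
qed

lemma vol_product_ge_cross_polytope:
  fixes K :: "(real^'n) set"
  assumes K: "compact K" "convex K" "0 \<in> interior K" and sym: "uminus ` K = K"
  shows "2 ^ CARD('n) / fact CARD('n) * vol (cball 0 1 :: (real^'n) set) \<le> vol K * vol (polar_body K)"
    "\<not> ellipsoid_at 0 K \<Longrightarrow>
      2 ^ CARD('n) / fact CARD('n) * vol (cball 0 1 :: (real^'n) set) < vol K * vol (polar_body K)"
proof -
  let ?\<omega> = "vol (cball 0 1 :: (real^'n) set)" and ?q = "2 ^ CARD('n) / fact CARD('n) :: real"
  obtain M b where Mb: "(M, b) \<in> admissible K" "det M \<noteq> 0"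
    and max: "\<And>N d. (N, d) \<in> admissible K \<Longrightarrow> \<bar>det N\<bar> \<le> \<bar>det M\<bar>"
    using lowner_exists[OF K(1,3)] by blast
  \<comment> \<open>Combining the constraints at \<open>x\<close> and \<open>- x\<close> recentres
    the ellipsoid at the origin with the same \<open>M\<close>, so \<open>(M, 0)\<close> is still
    maximal.\<close>
  have "norm (M *v x) \<le> 1" if "x \<in> K" for x
  proof -
    have "- x \<in> K" using sym that by blast
    then have "norm (M *v x - b) \<le> 1" "norm (M *v (- x) - b) \<le> 1"
      using Mb(1) that by (auto simp: admissible_def)
    then have "norm ((M *v x - b) - (M *v (- x) - b)) \<le> 1 + 1"
      by (intro norm_triangle_le_diff) simp
    also have "(M *v x - b) - (M *v (- x) - b) = 2 *\<^sub>R (M *v x)"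
      by (simp add: linear_neg[OF matrix_vector_mul_linear] scaleR_2)
    finally show ?thesis by simp
  qed
  then have M: "(M, 0) \<in> admissible K" "det M \<noteq> 0" using Mb(2) by (auto simp: admissible_def)
  have q: "?q * ?\<omega> \<le> vol K * (\<bar>det M\<bar> * ?\<omega>)"
    using mult_right_mono[OF john_position(2)[OF K M max sym refl], where c = ?\<omega>] by (simp add: mult_ac)
  also have "\<dots> \<le> vol K * vol (polar_body K)"
    by (intro mult_left_mono vol_polar_ge(1)[OF K M]) simp
  finally show "?q * ?\<omega> \<le> vol K * vol (polar_body K)" .
  assume "\<not> ellipsoid_at 0 K"
  then have "vol K * (\<bar>det M\<bar> * ?\<omega>) < vol K * vol (polar_body K)"
    by (intro mult_strict_left_mono vol_polar_ge(2)[OF K M] vol_pos K) 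
  with q show "?q * ?\<omega> < vol K * vol (polar_body K)" by linarith
qed

text \<open>Covers the bodies excluded from the strict bounds. With the pair that describes
  \<open>K\<close> itself, the determinant cancels against the volume of \<open>K\<close>.\<close>

lemma vol_product_ellipsoid:
  fixes K :: "(real^'n) set"
  assumes K: "compact K" "convex K" "0 \<in> interior K" and E: "ellipsoid_at 0 K"
  shows "(vol (cball 0 1 :: (real^'n) set))\<^sup>2 \<le> vol K * vol (polar_body K)"
proof -
  let ?\<omega> = "vol (cball 0 1 :: (real^'n) set)"
  obtain M :: "real^'n^'n" where M: "invertible M" and KM: "K = {x. norm (M *v x - M *v 0) \<le> 1}"
    by (rule ellipsoid_atE[OF E])
  have d: "det M \<noteq> 0" using M by (simp add: invertible_det_nz)
  have "(M, 0) \<in> admissible K" by (auto simp: admissible_def KM)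
  from vol_polar_ge(1)[OF K this d] have "vol K * (\<bar>det M\<bar> * ?\<omega>) \<le> vol K * vol (polar_body K)"
    by (intro mult_left_mono) simp_all
  moreover have "vol K = ?\<omega> / \<bar>det M\<bar>" unfolding KM by (rule ellipsoid_at_norm_le(2)[OF M refl])
  ultimately show ?thesis using d by (simp add: power2_eq_square)
qed

theorem theorem1p1:
  fixes K :: "(real^'n) set"
  assumes "compact K" and "convex K" and "0 \<in> interior K"
  shows
    "(vol K * vol (polar_body K)
        \<ge> max (evr K ^ CARD('n)) (evr (polar_body K) ^ CARD('n)) * (vol (cball 0 1 :: (real^'n) set))\<^sup>2
      \<and> (\<not> ellipsoid_at 0 K \<longrightarrow>
          vol K * vol (polar_body K)
            > max (evr K ^ CARD('n)) (evr (polar_body K) ^ CARD('n)) * (vol (cball 0 1 :: (real^'n) set))\<^sup>2))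
    \<and>
     (uminus ` K = K \<longrightarrow>
        vol K * vol (polar_body K)
          \<ge> (2 ^ CARD('n) * Gamma (real CARD('n) / 2 + 1)
               / (fact CARD('n) * pi powr (real CARD('n) / 2)))
             * (vol (cball 0 1 :: (real^'n) set))\<^sup>2
      \<and> (CARD('n) \<ge> 2 \<longrightarrow>
          vol K * vol (polar_body K)
            > (2 ^ CARD('n) * Gamma (real CARD('n) / 2 + 1)
                 / (fact CARD('n) * pi powr (real CARD('n) / 2)))
               * (vol (cball 0 1 :: (real^'n) set))\<^sup>2))
    \<and>
     (vol K * vol (polar_body K)
        \<ge> ((real CARD('n) + 1) powr ((real CARD('n) + 1) / 2) * Gamma (real CARD('n) / 2 + 1)
             / (fact CARD('n) * (real CARD('n) * pi) powr (real CARD('n) / 2)))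
           * (vol (cball 0 1 :: (real^'n) set))\<^sup>2
      \<and> (CARD('n) \<ge> 2 \<or> \<not> ellipsoid_at 0 K \<longrightarrow>
          vol K * vol (polar_body K)
            > ((real CARD('n) + 1) powr ((real CARD('n) + 1) / 2) * Gamma (real CARD('n) / 2 + 1)
                 / (fact CARD('n) * (real CARD('n) * pi) powr (real CARD('n) / 2)))
               * (vol (cball 0 1 :: (real^'n) set))\<^sup>2))"
proof -
  let ?n = "CARD('n)" and ?\<omega> = "vol (cball 0 1 :: (real^'n) set)" and ?P = "vol K * vol (polar_body K)"
  let ?c2 = "2 ^ ?n * Gamma (real ?n / 2 + 1) / (fact ?n * pi powr (real ?n / 2))"
  let ?c3 = "(real ?n + 1) powr ((real ?n + 1) / 2) * Gamma (real ?n / 2 + 1)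
             / (fact ?n * (real ?n * pi) powr (real ?n / 2))"
  let ?q = "sqrt (real ?n + 1) ^ Suc ?n / (fact ?n * sqrt (real ?n) ^ ?n)"
  note polar = polar_body_props[OF compact_imp_bounded[OF assms(1)] assms(3)]
  have bip: "polar_body (polar_body K) = K"
    using assms interior_subset by (intro bipolar) (auto intro: compact_imp_closed)
  have ell: "ellipsoid_at 0 K" if "ellipsoid_at 0 (polar_body K)"
    using polar_of_ellipsoid[OF that] unfolding bip .
  have n: "1 \<le> ?n" by (simp add: Suc_leI)
  have \<omega>: "0 < ?\<omega>" by (rule vol_unit_cball_pos)
  have "Gamma (real ?n / 2 + 1) > 0" by (intro Gamma_real_pos) auto
  then have c2: "?c2 * ?\<omega>\<^sup>2 = 2 ^ ?n / fact ?n * ?\<omega>" and c3: "?c3 * ?\<omega>\<^sup>2 = ?q * ?\<omega>"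
    unfolding simplex_powr[OF n] by (simp_all add: vol_unit_cball power2_eq_square del: power_Suc)
  \<comment> \<open>Transfers strictness for centred ellipsoids from the cross-polytope constant to
    the simplex constant.\<close>
  have c32: "?c3 \<le> ?c2"
    unfolding simplex_powr[OF n] using simplex_le_cross_polytope[OF n] \<open>Gamma (real ?n / 2 + 1) > 0\<close>
    by (intro divide_right_mono mult_right_mono) auto
  \<comment> \<open>For a centred ellipsoid strictness comes from the constant being below 1. This
    requires n >= 2, since for n = 1 the constant is 1 and equality occurs.\<close>
  have small: "?c2 * ?\<omega>\<^sup>2 < ?P" if "2 \<le> ?n" "ellipsoid_at 0 K"
  proof -
    have "?c2 * ?\<omega>\<^sup>2 < 1 * ?\<omega>\<^sup>2"
      using \<omega> by (intro mult_strict_right_mono cross_polytope_ratio_less_1 that(1)) simp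
    also have "\<dots> \<le> ?P" using vol_product_ellipsoid[OF assms that(2)] by simp
    finally show ?thesis .
  qed
  have "max (evr K ^ ?n) (evr (polar_body K) ^ ?n) * ?\<omega>\<^sup>2 \<le> ?P"
    using vol_product_ge_evr(1)[OF assms] vol_product_ge_evr(1)[OF polar]
    by (simp add: max_def bip mult.commute)
  moreover have "max (evr K ^ ?n) (evr (polar_body K) ^ ?n) * ?\<omega>\<^sup>2 < ?P" if "\<not> ellipsoid_at 0 K"
    using vol_product_ge_evr(2)[OF assms that] vol_product_ge_evr(2)[OF polar] ell that
    by (auto simp: max_def bip mult.commute)
  moreover have "?c2 * ?\<omega>\<^sup>2 \<le> ?P" if "uminus ` K = K"
    unfolding c2 by (rule vol_product_ge_cross_polytope(1)[OF assms that])
  moreover have "?c2 * ?\<omega>\<^sup>2 < ?P" if "uminus ` K = K" "2 \<le> ?n"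
    using small[OF that(2)] vol_product_ge_cross_polytope(2)[OF assms that(1)] unfolding c2 by blast
  moreover have "?c3 * ?\<omega>\<^sup>2 \<le> ?P"
    unfolding c3 by (rule vol_product_ge_simplex(1)[OF assms])
  moreover have "?c3 * ?\<omega>\<^sup>2 < ?P" if "2 \<le> ?n \<or> \<not> ellipsoid_at 0 K"
  proof (cases "ellipsoid_at 0 K")
    case True
    then have "?c2 * ?\<omega>\<^sup>2 < ?P" using small that by blast
    moreover have "?c3 * ?\<omega>\<^sup>2 \<le> ?c2 * ?\<omega>\<^sup>2" by (intro mult_right_mono c32) simp
    ultimately show ?thesis by linarith
  next
    case False
    then show ?thesis unfolding c3 by (rule vol_product_ge_simplex(2)[OF assms])
  qed
  ultimately show ?thesis by blast
qed

end
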